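(* Let $\alpha:H\Rightarrow K$ be a 2-cell in $\widetilde{\mathbf{Tricat}}$ whose source and target tricategories are doubly degenerate. Then $\alpha$ gives rise to a monoidal transformation between the braided monoidal functors corresponding to $H$ and $K$.
   Context: Tricategories and weak functors are in Gurski's fully algebraic version of the Gordon–Power–Street definition. $\widetilde{\mathbf{Tricat}}$ is the bicategory with 0-cells tricategories, 1-cells functors, and 2-cells the locally iconic lax transformations, i.e. lax transformations whose 1- and 2-cell components are identities; so a 2-cell consists of 3-cell components indexed by the 2-cells of the source (forming icons between the local functors; an icon is an oplax transformation of bicategories whose component 1-cells are identities), together with 3-cell constraint data $\Pi$ and $M$ satisfying the transformation axioms. A tricategory is doubly degenerate if it has exactly one 0-cell and exactly one 1-cell. Its hom-bicategory has one object, hence is a monoidal category $(B,\otimes,U)$ (objects: 2-cells; morphisms: 3-cells; $\otimes$: composition along the 1-cell; $U$: identity 2-cell); composition gives a monoidal functor $\boxtimes:B\times B\to B$, and the associativity and unit adjoint equivalences give objects $A,L,R$ with duals $A^\cdot,L^\cdot,R^\cdot$. $B$ carries the braiding induced (by the Joyal–Street construction of a braiding from a multiplication) by the multiplication $\varphi(X,Y)=R\otimes((X\boxtimes Y)\otimes L^{\cdot})$, and the monoidal functor on hom-bicategories underlying a weak functor $H:B\to B'$ is braided. $H$ moreover has objects $\chi_H,\iota_H$ of $B'$ (with duals), natural isomorphisms $\chi_H\otimes'(HX\boxtimes' HY)\cong H(X\boxtimes Y)\otimes'\chi_H$, and isomorphisms $\omega_H,\gamma_H,\delta_H$. Between weak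 functors $H,K:B\to B'$ of doubly degenerate tricategories, a 2-cell of $\widetilde{\mathbf{Tricat}}$ amounts to: an icon between the local functors $H,K$ with components $\alpha_X:HX\to KX$, together with morphisms $\Pi:\chi_K\to\chi_H$ and $M:\iota_H\to\iota_K$ of $B'$, compatible with the naturality isomorphisms of $\chi$ and with $\omega,\gamma,\delta$. The monoidal transformation in the theorem is the one with components $\alpha_X$. *)

theory Defs
  imports Main
begin

section \<open>Bicategories\<close>

text \<open>Composition is written in applicative order: \<open>hc1 B g f\<close> is \<open>g\<close> after \<open>f\<close>, and
  \<open>asc B h g f\<close> goes from \<open>(h g) f\<close> to \<open>h (g f)\<close>.\<close>

record ('o, 'a, 'c) bicat =
  Ob :: "'o set"
  Arr :: "'a set"
  Src :: "'a \<Rightarrow> 'o"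
  Trg :: "'a \<Rightarrow> 'o"
  Cell :: "'c set"
  Dom :: "'c \<Rightarrow> 'a"
  Cod :: "'c \<Rightarrow> 'a"
  id1 :: "'o \<Rightarrow> 'a"
  id2 :: "'a \<Rightarrow> 'c"
  vc :: "'c \<Rightarrow> 'c \<Rightarrow> 'c"
  hc1 :: "'a \<Rightarrow> 'a \<Rightarrow> 'a"
  hc2 :: "'c \<Rightarrow> 'c \<Rightarrow> 'c"
  asc :: "'a \<Rightarrow> 'a \<Rightarrow> 'a \<Rightarrow> 'c"
  lun :: "'a \<Rightarrow> 'c"
  run :: "'a \<Rightarrow> 'c"

definition hom1 :: "('o, 'a, 'c) bicat \<Rightarrow> 'o \<Rightarrow> 'o \<Rightarrow> 'a set" where
  "hom1 B X Y = {f \<in> Arr B. Src B f = X \<and> Trg B f = Y}"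

definition hom2 :: "('o, 'a, 'c) bicat \<Rightarrow> 'a \<Rightarrow> 'a \<Rightarrow> 'c set" where
  "hom2 B f g = {\<alpha> \<in> Cell B. Dom B \<alpha> = f \<and> Cod B \<alpha> = g}"

definition inverse2 :: "('o, 'a, 'c) bicat \<Rightarrow> 'c \<Rightarrow> 'c \<Rightarrow> bool" where
  "inverse2 B \<alpha> \<beta> \<longleftrightarrow> \<alpha> \<in> Cell B \<and> \<beta> \<in> hom2 B (Cod B \<alpha>) (Dom B \<alpha>)
     \<and> vc B \<beta> \<alpha> = id2 B (Dom B \<alpha>) \<and> vc B \<alpha> \<beta> = id2 B (Cod B \<alpha>)"

definition iso2 :: "('o, 'a, 'c) bicat \<Rightarrow> 'c \<Rightarrow> bool" where
  "iso2 B \<alpha> \<longleftrightarrow> (\<exists>\<beta>. inverse2 B \<alpha> \<beta>)"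

definition inv2 :: "('o, 'a, 'c) bicat \<Rightarrow> 'c \<Rightarrow> 'c" where
  "inv2 B \<alpha> = (THE \<beta>. inverse2 B \<alpha> \<beta>)"

locale bicategory =
  fixes B :: "('o, 'a, 'c) bicat"
  assumes Src_Ob: "f \<in> Arr B \<Longrightarrow> Src B f \<in> Ob B"
    and Trg_Ob: "f \<in> Arr B \<Longrightarrow> Trg B f \<in> Ob B"
    and Dom_Arr: "\<alpha> \<in> Cell B \<Longrightarrow> Dom B \<alpha> \<in> Arr B"
    and Cod_hom1: "\<alpha> \<in> Cell B \<Longrightarrow> Cod B \<alpha> \<in> hom1 B (Src B (Dom B \<alpha>)) (Trg B (Dom B \<alpha>))"
    and id2_hom2: "f \<in> Arr B \<Longrightarrow> id2 B f \<in> hom2 B f f"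
    and vc_hom2: "\<lbrakk>\<alpha> \<in> hom2 B f g; \<beta> \<in> hom2 B g h\<rbrakk> \<Longrightarrow> vc B \<beta> \<alpha> \<in> hom2 B f h"
    and vc_assoc: "\<lbrakk>\<alpha> \<in> hom2 B f g; \<beta> \<in> hom2 B g h; \<gamma> \<in> hom2 B h k\<rbrakk>
        \<Longrightarrow> vc B (vc B \<gamma> \<beta>) \<alpha> = vc B \<gamma> (vc B \<beta> \<alpha>)"
    and vc_id_right: "\<alpha> \<in> hom2 B f g \<Longrightarrow> vc B \<alpha> (id2 B f) = \<alpha>"
    and vc_id_left: "\<alpha> \<in> hom2 B f g \<Longrightarrow> vc B (id2 B g) \<alpha> = \<alpha>"
    and id1_hom1: "X \<in> Ob B \<Longrightarrow> id1 B X \<in> hom1 B X X"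
    and hc1_hom1: "\<lbrakk>f \<in> hom1 B X Y; g \<in> hom1 B Y Z\<rbrakk> \<Longrightarrow> hc1 B g f \<in> hom1 B X Z"
    and hc2_hom2: "\<lbrakk>\<alpha> \<in> hom2 B f f'; \<beta> \<in> hom2 B g g'; Trg B f = Src B g\<rbrakk>
        \<Longrightarrow> hc2 B \<beta> \<alpha> \<in> hom2 B (hc1 B g f) (hc1 B g' f')"
    and hc2_id: "\<lbrakk>f \<in> hom1 B X Y; g \<in> hom1 B Y Z\<rbrakk>
        \<Longrightarrow> hc2 B (id2 B g) (id2 B f) = id2 B (hc1 B g f)"
    and interchange: "\<lbrakk>\<alpha> \<in> hom2 B f f'; \<alpha>' \<in> hom2 B f' f''; \<beta> \<in> hom2 B g g'; \<beta>' \<in> hom2 B g' g'';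
          Trg B f = Src B g\<rbrakk>
        \<Longrightarrow> hc2 B (vc B \<beta>' \<beta>) (vc B \<alpha>' \<alpha>) = vc B (hc2 B \<beta>' \<alpha>') (hc2 B \<beta> \<alpha>)"
    and asc_hom2: "\<lbrakk>f \<in> hom1 B W X; g \<in> hom1 B X Y; h \<in> hom1 B Y Z\<rbrakk>
        \<Longrightarrow> asc B h g f \<in> hom2 B (hc1 B (hc1 B h g) f) (hc1 B h (hc1 B g f))"
    and asc_iso: "\<lbrakk>f \<in> hom1 B W X; g \<in> hom1 B X Y; h \<in> hom1 B Y Z\<rbrakk> \<Longrightarrow> iso2 B (asc B h g f)"
    and asc_nat: "\<lbrakk>\<alpha> \<in> hom2 B f f'; \<beta> \<in> hom2 B g g'; \<gamma> \<in> hom2 B h h';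
          Trg B f = Src B g; Trg B g = Src B h\<rbrakk>
        \<Longrightarrow> vc B (asc B h' g' f') (hc2 B (hc2 B \<gamma> \<beta>) \<alpha>)
          = vc B (hc2 B \<gamma> (hc2 B \<beta> \<alpha>)) (asc B h g f)"
    and lun_hom2: "f \<in> hom1 B X Y \<Longrightarrow> lun B f \<in> hom2 B (hc1 B (id1 B Y) f) f"
    and lun_iso: "f \<in> Arr B \<Longrightarrow> iso2 B (lun B f)"
    and lun_nat: "\<lbrakk>\<alpha> \<in> hom2 B f f'; Trg B f = Y\<rbrakk>
        \<Longrightarrow> vc B (lun B f') (hc2 B (id2 B (id1 B Y)) \<alpha>) = vc B \<alpha> (lun B f)"
    and run_hom2: "f \<in> hom1 B X Y \<Longrightarrow> run B f \<in> hom2 B (hc1 B f (id1 B X)) f"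
    and run_iso: "f \<in> Arr B \<Longrightarrow> iso2 B (run B f)"
    and run_nat: "\<lbrakk>\<alpha> \<in> hom2 B f f'; Src B f = X\<rbrakk>
        \<Longrightarrow> vc B (run B f') (hc2 B \<alpha> (id2 B (id1 B X))) = vc B \<alpha> (run B f)"
    and pentagon: "\<lbrakk>f \<in> hom1 B V W; g \<in> hom1 B W X; h \<in> hom1 B X Y; k \<in> hom1 B Y Z\<rbrakk>
        \<Longrightarrow> vc B (asc B k h (hc1 B g f)) (asc B (hc1 B k h) g f)
          = vc B (hc2 B (id2 B k) (asc B h g f))
              (vc B (asc B k (hc1 B h g) f) (hc2 B (asc B k h g) (id2 B f)))"
    and triangle: "\<lbrakk>f \<in> hom1 B X Y; g \<in> hom1 B Y Z\<rbrakk>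
        \<Longrightarrow> vc B (hc2 B (id2 B g) (lun B f)) (asc B g (id1 B Y) f) = hc2 B (run B g) (id2 B f)"

definition prod_bicat ::
  "('o, 'a, 'c) bicat \<Rightarrow> ('p, 'b, 'd) bicat \<Rightarrow> ('o \<times> 'p, 'a \<times> 'b, 'c \<times> 'd) bicat" where
  "prod_bicat B C =
    \<lparr> Ob = Ob B \<times> Ob C, Arr = Arr B \<times> Arr C,
      Src = map_prod (Src B) (Src C), Trg = map_prod (Trg B) (Trg C),
      Cell = Cell B \<times> Cell C, Dom = map_prod (Dom B) (Dom C), Cod = map_prod (Cod B) (Cod C),
      id1 = map_prod (id1 B) (id1 C), id2 = map_prod (id2 B) (id2 C),
      vc = (\<lambda>(\<beta>, \<beta>') (\<alpha>, \<alpha>'). (vc B \<beta> \<alpha>, vc C \<beta>' \<alpha>')),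
      hc1 = (\<lambda>(g, g') (f, f'). (hc1 B g f, hc1 C g' f')),
      hc2 = (\<lambda>(\<beta>, \<beta>') (\<alpha>, \<alpha>'). (hc2 B \<beta> \<alpha>, hc2 C \<beta>' \<alpha>')),
      asc = (\<lambda>(h, h') (g, g') (f, f'). (asc B h g f, asc C h' g' f')),
      lun = map_prod (lun B) (lun C), run = map_prod (run B) (run C) \<rparr>"

definition terminal_bicat :: "(unit, unit, unit) bicat" where
  "terminal_bicat =
    \<lparr> Ob = {()}, Arr = {()}, Src = (\<lambda>_. ()), Trg = (\<lambda>_. ()), Cell = {()}, Dom = (\<lambda>_. ()),
      Cod = (\<lambda>_. ()), id1 = (\<lambda>_. ()), id2 = (\<lambda>_. ()), vc = (\<lambda>_ _. ()), hc1 = (\<lambda>_ _. ()),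
      hc2 = (\<lambda>_ _. ()), asc = (\<lambda>_ _ _. ()), lun = (\<lambda>_. ()), run = (\<lambda>_. ()) \<rparr>"


section \<open>Pasting\<close>

text \<open>
  A path is a list of 1-cells \<open>[f\<^sub>n, \<dots>, f\<^sub>1]\<close> in applicative order (the last entry is the
  first arrow); it stands for the right-bracketed composite \<open>f\<^sub>n (\<dots> (f\<^sub>2 f\<^sub>1))\<close>, the empty
  path standing for the identity. The argument \<open>X\<close> below is always the source object of the path.
  A \<^emph>\<open>bounded cell\<close> \<open>(s, \<alpha>, t)\<close> is a 2-cell \<open>\<alpha>\<close> from the composite of the path
  \<open>s\<close> to the composite of the path \<open>t\<close>. With these, a pasting diagram is a list of whiskered
  bounded cells, all associativity and unit isomorphisms being inserted by \<open>join\<close>.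
\<close>

type_synonym ('a, 'c) bcell = "'a list \<times> 'c \<times> 'a list"

fun ev :: "('o, 'a, 'c) bicat \<Rightarrow> 'o \<Rightarrow> 'a list \<Rightarrow> 'a" where
  "ev B X [] = id1 B X"
| "ev B X [f] = f"
| "ev B X (f # g # fs) = hc1 B f (ev B X (g # fs))"

definition path_trg :: "('o, 'a, 'c) bicat \<Rightarrow> 'o \<Rightarrow> 'a list \<Rightarrow> 'o" where
  "path_trg B X q = (if q = [] then X else Trg B (hd q))"

text \<open>\<open>join B X p q\<close> is the coherence isomorphism from the composite of \<open>p\<close> after \<open>q\<close> to the
  composite of the path \<open>p @ q\<close>.\<close>

fun join :: "('o, 'a, 'c) bicat \<Rightarrow> 'o \<Rightarrow> 'a list \<Rightarrow> 'a list \<Rightarrow> 'c" where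
  "join B X [] q = lun B (ev B X q)"
| "join B X [f] [] = run B f"
| "join B X [f] (g # q) = id2 B (hc1 B f (ev B X (g # q)))"
| "join B X (f # g # p) q =
     vc B (hc2 B (id2 B f) (join B X (g # p) q))
       (asc B f (ev B (path_trg B X q) (g # p)) (ev B X q))"

text \<open>\<open>step B X p (s, \<alpha>, t) q\<close> is \<open>p \<alpha> q\<close>, from the composite of \<open>p @ s @ q\<close> to
  that of \<open>p @ t @ q\<close>.\<close>

fun step :: "('o, 'a, 'c) bicat \<Rightarrow> 'o \<Rightarrow> 'a list \<Rightarrow> ('a, 'c) bcell \<Rightarrow> 'a list \<Rightarrow> 'c" where
  "step B X p (s, \<alpha>, t) q =
     vc B (join B X p (t @ q))
       (vc B (hc2 B (id2 B (ev B (path_trg B X (s @ q)) p))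
               (vc B (join B X t q) (vc B (hc2 B \<alpha> (id2 B (ev B X q))) (inv2 B (join B X s q)))))
         (inv2 B (join B X p (s @ q))))"

text \<open>Vertical composite of a list of 2-cells, the head being applied first.\<close>

fun paste :: "('o, 'a, 'c) bicat \<Rightarrow> 'c list \<Rightarrow> 'c" where
  "paste B [] = undefined"
| "paste B [\<alpha>] = \<alpha>"
| "paste B (\<alpha> # \<beta> # \<beta>s) = vc B (paste B (\<beta> # \<beta>s)) \<alpha>"


section \<open>Weak functors\<close>

text \<open>\<open>fmul F g f : Fg \<circ> Ff \<rightarrow> F(g \<circ> f)\<close> and
  \<open>funt F X : id \<rightarrow> F(id)\<close> are the constraints.\<close>

record ('o, 'a, 'c, 'p, 'b, 'd) psf =
  fsrc :: "('o, 'a, 'c) bicat"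
  ftrg :: "('p, 'b, 'd) bicat"
  f0 :: "'o \<Rightarrow> 'p"
  f1 :: "'a \<Rightarrow> 'b"
  f2 :: "'c \<Rightarrow> 'd"
  fmul :: "'a \<Rightarrow> 'a \<Rightarrow> 'd"
  funt :: "'o \<Rightarrow> 'd"

locale pseudofunctor =
  fixes F :: "('o, 'a, 'c, 'p, 'b, 'd) psf"
    and B :: "('o, 'a, 'c) bicat" and C :: "('p, 'b, 'd) bicat"
  defines "B \<equiv> fsrc F" and "C \<equiv> ftrg F"
  assumes src_bicat: "bicategory B" and trg_bicat: "bicategory C"
    and f0_Ob: "X \<in> Ob B \<Longrightarrow> f0 F X \<in> Ob C"
    and f1_hom1: "f \<in> hom1 B X Y \<Longrightarrow> f1 F f \<in> hom1 C (f0 F X) (f0 F Y)"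
    and f2_hom2: "\<alpha> \<in> hom2 B f g \<Longrightarrow> f2 F \<alpha> \<in> hom2 C (f1 F f) (f1 F g)"
    and f2_id: "f \<in> Arr B \<Longrightarrow> f2 F (id2 B f) = id2 C (f1 F f)"
    and f2_vc: "\<lbrakk>\<alpha> \<in> hom2 B f g; \<beta> \<in> hom2 B g h\<rbrakk> \<Longrightarrow> f2 F (vc B \<beta> \<alpha>) = vc C (f2 F \<beta>) (f2 F \<alpha>)"
    and fmul_hom2: "\<lbrakk>f \<in> hom1 B X Y; g \<in> hom1 B Y Z\<rbrakk>
        \<Longrightarrow> fmul F g f \<in> hom2 C (hc1 C (f1 F g) (f1 F f)) (f1 F (hc1 B g f))"
    and fmul_iso: "\<lbrakk>f \<in> hom1 B X Y; g \<in> hom1 B Y Z\<rbrakk> \<Longrightarrow> iso2 C (fmul F g f)"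
    and fmul_nat: "\<lbrakk>\<alpha> \<in> hom2 B f f'; \<beta> \<in> hom2 B g g'; Trg B f = Src B g\<rbrakk>
        \<Longrightarrow> vc C (fmul F g' f') (hc2 C (f2 F \<beta>) (f2 F \<alpha>)) = vc C (f2 F (hc2 B \<beta> \<alpha>)) (fmul F g f)"
    and funt_hom2: "X \<in> Ob B \<Longrightarrow> funt F X \<in> hom2 C (id1 C (f0 F X)) (f1 F (id1 B X))"
    and funt_iso: "X \<in> Ob B \<Longrightarrow> iso2 C (funt F X)"
    and fmul_assoc: "\<lbrakk>f \<in> hom1 B W X; g \<in> hom1 B X Y; h \<in> hom1 B Y Z\<rbrakk>
        \<Longrightarrow> vc C (f2 F (asc B h g f)) (vc C (fmul F (hc1 B h g) f) (hc2 C (fmul F h g) (id2 C (f1 F f))))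
          = vc C (fmul F h (hc1 B g f))
              (vc C (hc2 C (id2 C (f1 F h)) (fmul F g f)) (asc C (f1 F h) (f1 F g) (f1 F f)))"
    and funt_left: "f \<in> hom1 B X Y
        \<Longrightarrow> vc C (f2 F (lun B f)) (vc C (fmul F (id1 B Y) f) (hc2 C (funt F Y) (id2 C (f1 F f))))
          = lun C (f1 F f)"
    and funt_right: "f \<in> hom1 B X Y
        \<Longrightarrow> vc C (f2 F (run B f)) (vc C (fmul F f (id1 B X)) (hc2 C (id2 C (f1 F f)) (funt F X)))
          = run C (f1 F f)"

definition psf_id :: "('o, 'a, 'c) bicat \<Rightarrow> ('o, 'a, 'c, 'o, 'a, 'c) psf" where
  "psf_id B = \<lparr> fsrc = B, ftrg = B, f0 = id, f1 = id, f2 = id,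
     fmul = (\<lambda>g f. id2 B (hc1 B g f)), funt = (\<lambda>X. id2 B (id1 B X)) \<rparr>"

definition psf_comp ::
  "('p, 'b, 'd, 'q, 'e, 'g) psf \<Rightarrow> ('o, 'a, 'c, 'p, 'b, 'd) psf \<Rightarrow> ('o, 'a, 'c, 'q, 'e, 'g) psf" where
  "psf_comp G F = \<lparr> fsrc = fsrc F, ftrg = ftrg G,
     f0 = f0 G \<circ> f0 F, f1 = f1 G \<circ> f1 F, f2 = f2 G \<circ> f2 F,
     fmul = (\<lambda>g f. vc (ftrg G) (f2 G (fmul F g f)) (fmul G (f1 F g) (f1 F f))),
     funt = (\<lambda>X. vc (ftrg G) (f2 G (funt F X)) (funt G (f0 F X))) \<rparr>"

definition psf_pair ::
  "('o, 'a, 'c, 'p, 'b, 'd) psf \<Rightarrow> ('o, 'a, 'c, 'q, 'e, 'g) psf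
   \<Rightarrow> ('o, 'a, 'c, 'p \<times> 'q, 'b \<times> 'e, 'd \<times> 'g) psf" where
  "psf_pair F G = \<lparr> fsrc = fsrc F, ftrg = prod_bicat (ftrg F) (ftrg G),
     f0 = (\<lambda>X. (f0 F X, f0 G X)), f1 = (\<lambda>f. (f1 F f, f1 G f)), f2 = (\<lambda>\<alpha>. (f2 F \<alpha>, f2 G \<alpha>)),
     fmul = (\<lambda>g f. (fmul F g f, fmul G g f)), funt = (\<lambda>X. (funt F X, funt G X)) \<rparr>"

definition psf_fst ::
  "('o, 'a, 'c) bicat \<Rightarrow> ('p, 'b, 'd) bicat \<Rightarrow> ('o \<times> 'p, 'a \<times> 'b, 'c \<times> 'd, 'o, 'a, 'c) psf" where
  "psf_fst B C = \<lparr> fsrc = prod_bicat B C, ftrg = B, f0 = fst, f1 = fst, f2 = fst,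
     fmul = (\<lambda>g f. id2 B (hc1 B (fst g) (fst f))), funt = (\<lambda>X. id2 B (id1 B (fst X))) \<rparr>"

definition psf_snd ::
  "('o, 'a, 'c) bicat \<Rightarrow> ('p, 'b, 'd) bicat \<Rightarrow> ('o \<times> 'p, 'a \<times> 'b, 'c \<times> 'd, 'p, 'b, 'd) psf" where
  "psf_snd B C = \<lparr> fsrc = prod_bicat B C, ftrg = C, f0 = snd, f1 = snd, f2 = snd,
     fmul = (\<lambda>g f. id2 C (hc1 C (snd g) (snd f))), funt = (\<lambda>X. id2 C (id1 C (snd X))) \<rparr>"

definition psf_bang :: "('o, 'a, 'c) bicat \<Rightarrow> ('o, 'a, 'c, unit, unit, unit) psf" where
  "psf_bang B = \<lparr> fsrc = B, ftrg = terminal_bicat, f0 = (\<lambda>_. ()), f1 = (\<lambda>_. ()), f2 = (\<lambda>_. ()),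
     fmul = (\<lambda>_ _. ()), funt = (\<lambda>_. ()) \<rparr>"

definition psf_const ::
  "('o, 'a, 'c) bicat \<Rightarrow> ('p, 'b, 'd) bicat \<Rightarrow> 'p \<Rightarrow> ('o, 'a, 'c, 'p, 'b, 'd) psf" where
  "psf_const B C Y = \<lparr> fsrc = B, ftrg = C, f0 = (\<lambda>_. Y), f1 = (\<lambda>_. id1 C Y), f2 = (\<lambda>_. id2 C (id1 C Y)),
     fmul = (\<lambda>_ _. lun C (id1 C Y)), funt = (\<lambda>_. id2 C (id1 C Y)) \<rparr>"

text \<open>The constraint from the composite of the path \<open>map (f1 F) fs\<close> to the image of the composite
  of \<open>fs\<close>, and the image of a bounded cell, which goes between the paths of images.\<close>

fun path_mul :: "('o, 'a, 'c, 'p, 'b, 'd) psf \<Rightarrow> 'o \<Rightarrow> 'a list \<Rightarrow> 'd" where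
  "path_mul F X [] = funt F X"
| "path_mul F X [f] = id2 (ftrg F) (f1 F f)"
| "path_mul F X (f # g # fs) =
     vc (ftrg F) (fmul F f (ev (fsrc F) X (g # fs)))
       (hc2 (ftrg F) (id2 (ftrg F) (f1 F f)) (path_mul F X (g # fs)))"

fun psf_image :: "('o, 'a, 'c, 'p, 'b, 'd) psf \<Rightarrow> 'o \<Rightarrow> ('a, 'c) bcell \<Rightarrow> ('b, 'd) bcell" where
  "psf_image F X (s, \<alpha>, t) =
     (map (f1 F) s,
      vc (ftrg F) (inv2 (ftrg F) (path_mul F X t)) (vc (ftrg F) (f2 F \<alpha>) (path_mul F X s)),
      map (f1 F) t)"


section \<open>Weak transformations, modifications, adjoint equivalences\<close>

text \<open>The naturality cell \<open>tn t f\<close> at \<open>f : X \<rightarrow> Y\<close> goes from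
  \<open>t\<^sub>Y \<circ> Ff\<close> to \<open>Gf \<circ> t\<^sub>X\<close>.\<close>

record ('o, 'a, 'c, 'p, 'b, 'd) tr =
  tsrc :: "('o, 'a, 'c, 'p, 'b, 'd) psf"
  ttrg :: "('o, 'a, 'c, 'p, 'b, 'd) psf"
  tc :: "'o \<Rightarrow> 'b"
  tn :: "'a \<Rightarrow> 'd"

locale pseudonat =
  fixes t :: "('o, 'a, 'c, 'p, 'b, 'd) tr"
    and F :: "('o, 'a, 'c, 'p, 'b, 'd) psf" and G :: "('o, 'a, 'c, 'p, 'b, 'd) psf"
    and B :: "('o, 'a, 'c) bicat" and C :: "('p, 'b, 'd) bicat"
  defines "F \<equiv> tsrc t" and "G \<equiv> ttrg t" and "B \<equiv> fsrc (tsrc t)" and "C \<equiv> ftrg (tsrc t)"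
  assumes src_psf: "pseudofunctor F" and trg_psf: "pseudofunctor G"
    and parallel: "fsrc G = B" "ftrg G = C"
    and tc_hom1: "X \<in> Ob B \<Longrightarrow> tc t X \<in> hom1 C (f0 F X) (f0 G X)"
    and tn_hom2: "f \<in> hom1 B X Y
        \<Longrightarrow> tn t f \<in> hom2 C (hc1 C (tc t Y) (f1 F f)) (hc1 C (f1 G f) (tc t X))"
    and tn_iso: "f \<in> Arr B \<Longrightarrow> iso2 C (tn t f)"
    and tn_nat: "\<lbrakk>\<alpha> \<in> hom2 B f g; f \<in> hom1 B X Y\<rbrakk>
        \<Longrightarrow> vc C (tn t g) (hc2 C (id2 C (tc t Y)) (f2 F \<alpha>))
          = vc C (hc2 C (f2 G \<alpha>) (id2 C (tc t X))) (tn t f)"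
    and tn_comp: "\<lbrakk>f \<in> hom1 B X Y; g \<in> hom1 B Y Z\<rbrakk>
        \<Longrightarrow> vc C (tn t (hc1 B g f)) (step C (f0 F X) [tc t Z] ([f1 F g, f1 F f], fmul F g f, [f1 F (hc1 B g f)]) [])
          = paste C
              [step C (f0 F X) [] ([tc t Z, f1 F g], tn t g, [f1 G g, tc t Y]) [f1 F f],
               step C (f0 F X) [f1 G g] ([tc t Y, f1 F f], tn t f, [f1 G f, tc t X]) [],
               step C (f0 F X) [] ([f1 G g, f1 G f], fmul G g f, [f1 G (hc1 B g f)]) [tc t X]]"
    and tn_unit: "X \<in> Ob B
        \<Longrightarrow> vc C (tn t (id1 B X)) (step C (f0 F X) [tc t X] ([], funt F X, [f1 F (id1 B X)]) [])
          = step C (f0 F X) [] ([], funt G X, [f1 G (id1 B X)]) [tc t X]"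

definition tr_id :: "('o, 'a, 'c, 'p, 'b, 'd) psf \<Rightarrow> ('o, 'a, 'c, 'p, 'b, 'd) tr" where
  "tr_id F = \<lparr> tsrc = F, ttrg = F, tc = (\<lambda>X. id1 (ftrg F) (f0 F X)),
     tn = (\<lambda>f. vc (ftrg F) (inv2 (ftrg F) (run (ftrg F) (f1 F f))) (lun (ftrg F) (f1 F f))) \<rparr>"

text \<open>\<open>tr_comp s t\<close> is the vertical composite \<open>s\<close> after \<open>t\<close>.\<close>

definition tr_comp ::
  "('o, 'a, 'c, 'p, 'b, 'd) tr \<Rightarrow> ('o, 'a, 'c, 'p, 'b, 'd) tr \<Rightarrow> ('o, 'a, 'c, 'p, 'b, 'd) tr" where
  "tr_comp s t = (let B = fsrc (tsrc t); C = ftrg (tsrc t); F = tsrc t; G = ttrg t; H = ttrg s in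
     \<lparr> tsrc = F, ttrg = H, tc = (\<lambda>X. hc1 C (tc s X) (tc t X)),
       tn = (\<lambda>f. let X = Src B f; Y = Trg B f in
         paste C
           [asc C (tc s Y) (tc t Y) (f1 F f),
            hc2 C (id2 C (tc s Y)) (tn t f),
            inv2 C (asc C (tc s Y) (f1 G f) (tc t X)),
            hc2 C (tn s f) (id2 C (tc t X)),
            asc C (f1 H f) (tc s X) (tc t X)]) \<rparr>)"

definition tr_whisker_left ::
  "('p, 'b, 'd, 'q, 'e, 'g) psf \<Rightarrow> ('o, 'a, 'c, 'p, 'b, 'd) tr \<Rightarrow> ('o, 'a, 'c, 'q, 'e, 'g) tr" where
  "tr_whisker_left M t = (let B = fsrc (tsrc t); F = tsrc t; G = ttrg t; D = ftrg M in
     \<lparr> tsrc = psf_comp M F, ttrg = psf_comp M G, tc = (\<lambda>X. f1 M (tc t X)),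
       tn = (\<lambda>f. let X = Src B f; Y = Trg B f in
         paste D
           [fmul M (tc t Y) (f1 F f), f2 M (tn t f), inv2 D (fmul M (f1 G f) (tc t X))]) \<rparr>)"

definition tr_whisker_right ::
  "('p, 'b, 'd, 'q, 'e, 'g) tr \<Rightarrow> ('o, 'a, 'c, 'p, 'b, 'd) psf \<Rightarrow> ('o, 'a, 'c, 'q, 'e, 'g) tr" where
  "tr_whisker_right t P =
     \<lparr> tsrc = psf_comp (tsrc t) P, ttrg = psf_comp (ttrg t) P,
       tc = (\<lambda>X. tc t (f0 P X)), tn = (\<lambda>f. tn t (f1 P f)) \<rparr>"

definition tr_pair ::
  "('o, 'a, 'c, 'p, 'b, 'd) tr \<Rightarrow> ('o, 'a, 'c, 'q, 'e, 'g) tr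
   \<Rightarrow> ('o, 'a, 'c, 'p \<times> 'q, 'b \<times> 'e, 'd \<times> 'g) tr" where
  "tr_pair s t =
     \<lparr> tsrc = psf_pair (tsrc s) (tsrc t), ttrg = psf_pair (ttrg s) (ttrg t),
       tc = (\<lambda>X. (tc s X, tc t X)), tn = (\<lambda>f. (tn s f, tn t f)) \<rparr>"

text \<open>Invertible modifications between parallel transformations. Only the action on 1-cells of the
  two bounding functors enters.\<close>

locale invertible_modification =
  fixes s :: "('o, 'a, 'c, 'p, 'b, 'd) tr" and t :: "('o, 'a, 'c, 'p, 'b, 'd) tr"
    and \<Gamma> :: "'o \<Rightarrow> 'd"
    and F :: "('o, 'a, 'c, 'p, 'b, 'd) psf" and G :: "('o, 'a, 'c, 'p, 'b, 'd) psf"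
    and B :: "('o, 'a, 'c) bicat" and C :: "('p, 'b, 'd) bicat"
  defines "F \<equiv> tsrc s" and "G \<equiv> ttrg s" and "B \<equiv> fsrc (tsrc s)" and "C \<equiv> ftrg (tsrc s)"
  assumes comp_hom2: "X \<in> Ob B \<Longrightarrow> \<Gamma> X \<in> hom2 C (tc s X) (tc t X)"
    and comp_iso: "X \<in> Ob B \<Longrightarrow> iso2 C (\<Gamma> X)"
    and comp_nat: "f \<in> hom1 B X Y
        \<Longrightarrow> vc C (hc2 C (id2 C (f1 G f)) (\<Gamma> X)) (tn s f) = vc C (tn t f) (hc2 C (\<Gamma> Y) (id2 C (f1 F f)))"

record ('o, 'a, 'c, 'p, 'b, 'd) adj =
  fwd :: "('o, 'a, 'c, 'p, 'b, 'd) tr"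
  bwd :: "('o, 'a, 'c, 'p, 'b, 'd) tr"
  eta :: "'o \<Rightarrow> 'd"
  eps :: "'o \<Rightarrow> 'd"

locale adjoint_equivalence =
  fixes e :: "('o, 'a, 'c, 'p, 'b, 'd) adj"
    and F :: "('o, 'a, 'c, 'p, 'b, 'd) psf" and G :: "('o, 'a, 'c, 'p, 'b, 'd) psf"
    and C :: "('p, 'b, 'd) bicat"
  defines "C \<equiv> ftrg F"
  assumes fwd_nat: "pseudonat (fwd e)" and bwd_nat: "pseudonat (bwd e)"
    and fwd_src: "tsrc (fwd e) = F" and fwd_trg: "ttrg (fwd e) = G"
    and bwd_src: "tsrc (bwd e) = G" and bwd_trg: "ttrg (bwd e) = F"
    and eta_mod: "invertible_modification (tr_id F) (tr_comp (bwd e) (fwd e)) (eta e)"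
    and eps_mod: "invertible_modification (tr_comp (fwd e) (bwd e)) (tr_id G) (eps e)"
    and triangle_fwd: "X \<in> Ob (fsrc F)
        \<Longrightarrow> paste C
             [step C (f0 F X) [tc (fwd e) X] ([], eta e X, [tc (bwd e) X, tc (fwd e) X]) [],
              step C (f0 F X) [] ([tc (fwd e) X, tc (bwd e) X], eps e X, []) [tc (fwd e) X]]
          = id2 C (tc (fwd e) X)"
    and triangle_bwd: "X \<in> Ob (fsrc F)
        \<Longrightarrow> paste C
             [step C (f0 G X) [] ([], eta e X, [tc (bwd e) X, tc (fwd e) X]) [tc (bwd e) X],
              step C (f0 G X) [tc (bwd e) X] ([tc (fwd e) X, tc (bwd e) X], eps e X, []) []]
          = id2 C (tc (bwd e) X)"


section \<open>Tricategories\<close>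

text \<open>
  \<open>ten T a b c\<close> is composition \<open>T(b,c) \<times> T(a,b) \<rightarrow> T(a,c)\<close>, \<open>uni T a\<close> the unit
  \<open>1 \<rightarrow> T(a,a)\<close>; \<open>ass\<close>, \<open>lft\<close>, \<open>rgt\<close> are the adjoint equivalences with components
  \<open>(h g) f \<rightarrow> h (g f)\<close>, \<open>I f \<rightarrow> f\<close>, \<open>f I \<rightarrow> f\<close>; the remaining fields are the
  modifications \<open>\<pi>\<close>, \<open>\<mu>\<close>, \<open>\<lambda>\<close>, \<open>\<rho>\<close>.
\<close>

record ('o, 'f, 'x, 'm) tricat =
  T0 :: "'o set"
  Hom :: "'o \<Rightarrow> 'o \<Rightarrow> ('f, 'x, 'm) bicat"
  ten :: "'o \<Rightarrow> 'o \<Rightarrow> 'o \<Rightarrow> ('f \<times> 'f, 'x \<times> 'x, 'm \<times> 'm, 'f, 'x, 'm) psf"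
  uni :: "'o \<Rightarrow> (unit, unit, unit, 'f, 'x, 'm) psf"
  ass :: "'o \<Rightarrow> 'o \<Rightarrow> 'o \<Rightarrow> 'o
      \<Rightarrow> ('f \<times> 'f \<times> 'f, 'x \<times> 'x \<times> 'x, 'm \<times> 'm \<times> 'm, 'f, 'x, 'm) adj"
  lft :: "'o \<Rightarrow> 'o \<Rightarrow> ('f, 'x, 'm, 'f, 'x, 'm) adj"
  rgt :: "'o \<Rightarrow> 'o \<Rightarrow> ('f, 'x, 'm, 'f, 'x, 'm) adj"
  tpi :: "'o \<Rightarrow> 'o \<Rightarrow> 'o \<Rightarrow> 'o \<Rightarrow> 'o \<Rightarrow> 'f \<times> 'f \<times> 'f \<times> 'f \<Rightarrow> 'm"
  tmu :: "'o \<Rightarrow> 'o \<Rightarrow> 'o \<Rightarrow> 'f \<times> 'f \<Rightarrow> 'm"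
  tlam :: "'o \<Rightarrow> 'o \<Rightarrow> 'o \<Rightarrow> 'f \<times> 'f \<Rightarrow> 'm"
  trho :: "'o \<Rightarrow> 'o \<Rightarrow> 'o \<Rightarrow> 'f \<times> 'f \<Rightarrow> 'm"

subsection \<open>The modifications, at the level of functors and transformations\<close>

text \<open>Composites of functors into hom-bicategories with the composition functor, and the corresponding
  operations on transformations.\<close>

definition tenF where
  "tenF T a b c G F = psf_comp (ten T a b c) (psf_pair G F)"

definition tenT where
  "tenT T a b c t s = tr_whisker_left (ten T a b c) (tr_pair t s)"

definition assT where
  "assT T a b c d H G F = tr_whisker_right (fwd (ass T a b c d)) (psf_pair H (psf_pair G F))"

definition unitF where
  "unitF T B a = psf_comp (uni T a) (psf_bang B)"

definition pi_src where
  "pi_src T a b c d e w x y z =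
     tr_comp (tenT T a d e (tr_id w) (assT T a b c d x y z))
       (tr_comp (assT T a b d e w (tenF T b c d x y) z)
         (tenT T a b e (assT T b c d e w x y) (tr_id z)))"

definition pi_trg where
  "pi_trg T a b c d e w x y z =
     tr_comp (assT T a c d e w x (tenF T a b c y z)) (assT T a b c e (tenF T c d e w x) y z)"

definition mu_src where
  "mu_src T a b c x y =
     tr_comp (tenT T a b c (tr_id x) (tr_whisker_right (fwd (lft T a b)) y))
       (tr_comp (assT T a b b c x (unitF T (fsrc y) b) y)
         (tenT T a b c (tr_whisker_right (bwd (rgt T b c)) x) (tr_id y)))"

definition lam_src where
  "lam_src T a b c x y = tenT T a b c (tr_whisker_right (fwd (lft T b c)) x) (tr_id y)"

definition lam_trg where
  "lam_trg T a b c x y =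
     tr_comp (tr_whisker_right (fwd (lft T a c)) (tenF T a b c x y)) (assT T a b c c (unitF T (fsrc x) c) x y)"

definition rho_src where
  "rho_src T a b c x y = tenT T a b c (tr_id x) (tr_whisker_right (bwd (rgt T a b)) y)"

definition rho_trg where
  "rho_trg T a b c x y =
     tr_comp (assT T a a b c x y (unitF T (fsrc y) a)) (tr_whisker_right (bwd (rgt T a c)) (tenF T a b c x y))"

subsection \<open>Components with their boundaries\<close>

text \<open>In the axioms, 1- and 2-cells are tagged with their source and target 0-cells, so that
  the indices of composition and of the structure cells can be left implicit.\<close>

type_synonym ('o, 'z) tg = "'o \<times> 'o \<times> 'z"

definition cell_of :: "('o, 'z) tg \<Rightarrow> 'z" where
  "cell_of = (\<lambda>(a, b, z). z)"

definition hom_of :: "('o, 'f, 'x, 'm) tricat \<Rightarrow> ('o, 'z) tg \<Rightarrow> ('f, 'x, 'm) bicat" where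
  "hom_of T = (\<lambda>(a, b, z). Hom T a b)"

definition tens0 :: "('o, 'f, 'x, 'm) tricat \<Rightarrow> ('o, 'f) tg \<Rightarrow> ('o, 'f) tg \<Rightarrow> ('o, 'f) tg" where
  "tens0 T = (\<lambda>(b, c, g) (a, _, f). (a, c, f0 (ten T a b c) (g, f)))"

definition tens1 :: "('o, 'f, 'x, 'm) tricat \<Rightarrow> ('o, 'x) tg \<Rightarrow> ('o, 'x) tg \<Rightarrow> ('o, 'x) tg" where
  "tens1 T = (\<lambda>(b, c, y) (a, _, x). (a, c, f1 (ten T a b c) (y, x)))"

abbreviation tens0_infix ("(_ \<otimes>\<^bsub>_\<^esub> _)" [71, 0, 70] 70) where
  "g \<otimes>\<^bsub>T\<^esub> f \<equiv> tens0 T g f"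

abbreviation tens1_infix ("(_ \<odot>\<^bsub>_\<^esub> _)" [71, 0, 70] 70) where
  "y \<odot>\<^bsub>T\<^esub> x \<equiv> tens1 T y x"

definition src1 :: "('o, 'f, 'x, 'm) tricat \<Rightarrow> ('o, 'x) tg \<Rightarrow> ('o, 'f) tg" where
  "src1 T = (\<lambda>(a, b, x). (a, b, Src (Hom T a b) x))"

definition trg1 :: "('o, 'f, 'x, 'm) tricat \<Rightarrow> ('o, 'x) tg \<Rightarrow> ('o, 'f) tg" where
  "trg1 T = (\<lambda>(a, b, x). (a, b, Trg (Hom T a b) x))"

definition idc :: "('o, 'f, 'x, 'm) tricat \<Rightarrow> ('o, 'f) tg \<Rightarrow> ('o, 'x) tg" where
  "idc T = (\<lambda>(a, b, f). (a, b, id1 (Hom T a b) f))"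

definition unit_src :: "('o, 'f, 'x, 'm) tricat \<Rightarrow> ('o, 'z) tg \<Rightarrow> ('o, 'f) tg" where
  "unit_src T = (\<lambda>(a, b, f). (a, a, f0 (uni T a) ()))"

definition unit_trg :: "('o, 'f, 'x, 'm) tricat \<Rightarrow> ('o, 'z) tg \<Rightarrow> ('o, 'f) tg" where
  "unit_trg T = (\<lambda>(a, b, f). (b, b, f0 (uni T b) ()))"

definition as1 ::
  "('o, 'f, 'x, 'm) tricat \<Rightarrow> ('o, 'f) tg \<Rightarrow> ('o, 'f) tg \<Rightarrow> ('o, 'f) tg \<Rightarrow> ('o, 'x) tg" where
  "as1 T = (\<lambda>(c, d, h) (b, _, g) (a, _, f). (a, d, tc (fwd (ass T a b c d)) (h, g, f)))"

definition lf1 :: "('o, 'f, 'x, 'm) tricat \<Rightarrow> ('o, 'f) tg \<Rightarrow> ('o, 'x) tg" where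
  "lf1 T = (\<lambda>(a, b, f). (a, b, tc (fwd (lft T a b)) f))"

text \<open>The adjoint inverse of the right unit, \<open>r\<^sup>\<cdot> : f \<rightarrow> f I\<close>.\<close>

definition rd1 :: "('o, 'f, 'x, 'm) tricat \<Rightarrow> ('o, 'f) tg \<Rightarrow> ('o, 'x) tg" where
  "rd1 T = (\<lambda>(a, b, f). (a, b, tc (bwd (rgt T a b)) f))"

definition as_nat ::
  "('o, 'f, 'x, 'm) tricat \<Rightarrow> ('o, 'x) tg \<Rightarrow> ('o, 'x) tg \<Rightarrow> ('o, 'x) tg \<Rightarrow> (('o, 'x) tg, 'm) bcell" where
  "as_nat T z y x =
     ([as1 T (trg1 T z) (trg1 T y) (trg1 T x), (z \<odot>\<^bsub>T\<^esub> y) \<odot>\<^bsub>T\<^esub> x],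
      (case (z, y, x) of ((c, d, z'), (b, _, y'), (a, _, x')) \<Rightarrow> tn (fwd (ass T a b c d)) (z', y', x')),
      [z \<odot>\<^bsub>T\<^esub> (y \<odot>\<^bsub>T\<^esub> x), as1 T (src1 T z) (src1 T y) (src1 T x)])"

definition pi_cell ::
  "('o, 'f, 'x, 'm) tricat \<Rightarrow> ('o, 'f) tg \<Rightarrow> ('o, 'f) tg \<Rightarrow> ('o, 'f) tg \<Rightarrow> ('o, 'f) tg
   \<Rightarrow> (('o, 'x) tg, 'm) bcell" where
  "pi_cell T w x y z =
     ([idc T w \<odot>\<^bsub>T\<^esub> as1 T x y z, as1 T w (x \<otimes>\<^bsub>T\<^esub> y) z, as1 T w x y \<odot>\<^bsub>T\<^esub> idc T z],
      (case (w, x, y, z) of ((d, e, w'), (c, _, x'), (b, _, y'), (a, _, z')) \<Rightarrow> tpi T a b c d e (w', x', y', z')),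
      [as1 T w x (y \<otimes>\<^bsub>T\<^esub> z), as1 T (w \<otimes>\<^bsub>T\<^esub> x) y z])"

definition mu_cell ::
  "('o, 'f, 'x, 'm) tricat \<Rightarrow> ('o, 'f) tg \<Rightarrow> ('o, 'f) tg \<Rightarrow> (('o, 'x) tg, 'm) bcell" where
  "mu_cell T x y =
     ([idc T x \<odot>\<^bsub>T\<^esub> lf1 T y, as1 T x (unit_trg T y) y, rd1 T x \<odot>\<^bsub>T\<^esub> idc T y],
      (case (x, y) of ((b, c, x'), (a, _, y')) \<Rightarrow> tmu T a b c (x', y')),
      [])"

definition lam_cell ::
  "('o, 'f, 'x, 'm) tricat \<Rightarrow> ('o, 'f) tg \<Rightarrow> ('o, 'f) tg \<Rightarrow> (('o, 'x) tg, 'm) bcell" where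
  "lam_cell T x y =
     ([lf1 T x \<odot>\<^bsub>T\<^esub> idc T y],
      (case (x, y) of ((b, c, x'), (a, _, y')) \<Rightarrow> tlam T a b c (x', y')),
      [lf1 T (x \<otimes>\<^bsub>T\<^esub> y), as1 T (unit_trg T x) x y])"

definition rho_cell ::
  "('o, 'f, 'x, 'm) tricat \<Rightarrow> ('o, 'f) tg \<Rightarrow> ('o, 'f) tg \<Rightarrow> (('o, 'x) tg, 'm) bcell" where
  "rho_cell T x y =
     ([idc T x \<odot>\<^bsub>T\<^esub> rd1 T y],
      (case (x, y) of ((b, c, x'), (a, _, y')) \<Rightarrow> trho T a b c (x', y')),
      [as1 T x y (unit_src T y), rd1 T (x \<otimes>\<^bsub>T\<^esub> y)])"

text \<open>The unit constraint \<open>1 \<rightarrow> 1 \<odot> 1\<close> of composition, and the interchange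
  \<open>(1 \<odot> x) (y \<odot> 1) \<rightarrow> (y \<odot> 1) (1 \<odot> x)\<close>.\<close>

definition ten_unit ::
  "('o, 'f, 'x, 'm) tricat \<Rightarrow> ('o, 'f) tg \<Rightarrow> ('o, 'f) tg \<Rightarrow> (('o, 'x) tg, 'm) bcell" where
  "ten_unit T g f =
     ([idc T (g \<otimes>\<^bsub>T\<^esub> f)],
      (case (g, f) of ((b, c, g'), (a, _, f')) \<Rightarrow> funt (ten T a b c) (g', f')),
      [idc T g \<odot>\<^bsub>T\<^esub> idc T f])"

definition ten_swap ::
  "('o, 'f, 'x, 'm) tricat \<Rightarrow> ('o, 'x) tg \<Rightarrow> ('o, 'x) tg \<Rightarrow> (('o, 'x) tg, 'm) bcell" where
  "ten_swap T y x =
     ([idc T (trg1 T y) \<odot>\<^bsub>T\<^esub> x, y \<odot>\<^bsub>T\<^esub> idc T (src1 T x)],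
      (case (y, x) of ((b, c, y'), (a, _, x')) \<Rightarrow>
        let M = ten T a b c; B = Hom T b c; C = Hom T a b; D = Hom T a c;
            g = Src B y'; g' = Trg B y'; f = Src C x'; f' = Trg C x'
        in paste D
             [fmul M (id1 B g', x') (y', id1 C f),
              f2 M (lun B y', run C x'),
              inv2 D (f2 M (run B y', lun C x')),
              inv2 D (fmul M (y', id1 C f') (id1 B g, x'))]),
      [y \<odot>\<^bsub>T\<^esub> idc T (trg1 T x), idc T (src1 T y) \<odot>\<^bsub>T\<^esub> x])"

definition id_cell :: "('o, 'f, 'x, 'm) tricat \<Rightarrow> ('o, 'x) tg \<Rightarrow> (('o, 'x) tg, 'm) bcell" where
  "id_cell T x = ([x], id2 (hom_of T x) (cell_of x), [x])"

text \<open>Composition along a 0-cell of two 3-cells, each bounded by single 2-cells.\<close>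

definition tens2 ::
  "('o, 'f, 'x, 'm) tricat \<Rightarrow> (('o, 'x) tg, 'm) bcell \<Rightarrow> (('o, 'x) tg, 'm) bcell
   \<Rightarrow> (('o, 'x) tg, 'm) bcell" where
  "tens2 T = (\<lambda>(s, \<beta>, t) (s', \<alpha>, t').
     ([hd s \<odot>\<^bsub>T\<^esub> hd s'],
      (case (hd s, hd s') of ((b, c, _), (a, _, _)) \<Rightarrow> f2 (ten T a b c) (\<beta>, \<alpha>)),
      [hd t \<odot>\<^bsub>T\<^esub> hd t']))"

text \<open>Whiskering a bounded 3-cell with a 1-cell on the left or right; \<open>X\<close> is the source of its
  bounding paths of 2-cells.\<close>

definition lwhisk ::
  "('o, 'f, 'x, 'm) tricat \<Rightarrow> ('o, 'f) tg \<Rightarrow> ('o, 'f) tg \<Rightarrow> (('o, 'x) tg, 'm) bcell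
   \<Rightarrow> (('o, 'x) tg, 'm) bcell" where
  "lwhisk T = (\<lambda>(b, c, g) (a, _, X) (s, \<alpha>, t).
     let A = Hom T a b;
         F = psf_comp (ten T a b c) (psf_pair (psf_const A (Hom T b c) g) (psf_id A));
         (s', \<alpha>', t') = psf_image F X (map cell_of s, \<alpha>, map cell_of t)
     in (map (\<lambda>x. (a, c, x)) s', \<alpha>', map (\<lambda>x. (a, c, x)) t'))"

definition rwhisk ::
  "('o, 'f, 'x, 'm) tricat \<Rightarrow> ('o, 'f) tg \<Rightarrow> (('o, 'x) tg, 'm) bcell \<Rightarrow> ('o, 'f) tg
   \<Rightarrow> (('o, 'x) tg, 'm) bcell" where
  "rwhisk T = (\<lambda>(b, c, X) (s, \<alpha>, t) (a, _, f).
     let A = Hom T b c;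
         F = psf_comp (ten T a b c) (psf_pair (psf_id A) (psf_const A (Hom T a b) f));
         (s', \<alpha>', t') = psf_image F X (map cell_of s, \<alpha>, map cell_of t)
     in (map (\<lambda>x. (a, c, x)) s', \<alpha>', map (\<lambda>x. (a, c, x)) t'))"

text \<open>Pasting steps in the hom-bicategory of \<open>X\<close>; \<open>backward\<close> uses the bounded cell backwards.\<close>

definition forward ::
  "('o, 'f, 'x, 'm) tricat \<Rightarrow> ('o, 'f) tg \<Rightarrow> ('o, 'x) tg list \<Rightarrow> (('o, 'x) tg, 'm) bcell
   \<Rightarrow> ('o, 'x) tg list \<Rightarrow> 'm" where
  "forward T X p = (\<lambda>(s, \<alpha>, t) q.
     step (hom_of T X) (cell_of X) (map cell_of p) (map cell_of s, \<alpha>, map cell_of t) (map cell_of q))"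

definition backward ::
  "('o, 'f, 'x, 'm) tricat \<Rightarrow> ('o, 'f) tg \<Rightarrow> ('o, 'x) tg list \<Rightarrow> (('o, 'x) tg, 'm) bcell
   \<Rightarrow> ('o, 'x) tg list \<Rightarrow> 'm" where
  "backward T X p = (\<lambda>(s, \<alpha>, t) q. forward T X p (t, inv2 (hom_of T X) \<alpha>, s) q)"

subsection \<open>The axioms\<close>

text \<open>The nonabelian 4-cocycle condition (the associahedron on five 1-cells).\<close>

definition cocycle_axiom ::
  "('o, 'f, 'x, 'm) tricat \<Rightarrow> ('o, 'f) tg \<Rightarrow> ('o, 'f) tg \<Rightarrow> ('o, 'f) tg \<Rightarrow> ('o, 'f) tg
   \<Rightarrow> ('o, 'f) tg \<Rightarrow> bool" where
  "cocycle_axiom T u v w x y \<longleftrightarrow>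
    (let X = (((u \<otimes>\<^bsub>T\<^esub> v) \<otimes>\<^bsub>T\<^esub> w) \<otimes>\<^bsub>T\<^esub> x) \<otimes>\<^bsub>T\<^esub> y; W = forward T X; V = backward T X; i = idc T; a = as1 T in
     paste (hom_of T X)
       [W [i u \<odot>\<^bsub>T\<^esub> (i v \<odot>\<^bsub>T\<^esub> a w x y), i u \<odot>\<^bsub>T\<^esub> a v (w \<otimes>\<^bsub>T\<^esub> x) y, a u (v \<otimes>\<^bsub>T\<^esub> (w \<otimes>\<^bsub>T\<^esub> x)) y]
          (rwhisk T (((u \<otimes>\<^bsub>T\<^esub> v) \<otimes>\<^bsub>T\<^esub> w) \<otimes>\<^bsub>T\<^esub> x) (pi_cell T u v w x) y)
          [],
        W [i u \<odot>\<^bsub>T\<^esub> (i v \<odot>\<^bsub>T\<^esub> a w x y)]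
          (pi_cell T u v (w \<otimes>\<^bsub>T\<^esub> x) y)
          [a (u \<otimes>\<^bsub>T\<^esub> v) w x \<odot>\<^bsub>T\<^esub> i y],
        V [] (as_nat T (i u) (i v) (a w x y))
          [a (u \<otimes>\<^bsub>T\<^esub> v) (w \<otimes>\<^bsub>T\<^esub> x) y, a (u \<otimes>\<^bsub>T\<^esub> v) w x \<odot>\<^bsub>T\<^esub> i y],
        V [a u v (w \<otimes>\<^bsub>T\<^esub> (x \<otimes>\<^bsub>T\<^esub> y))]
          (tens2 T (ten_unit T u v) (id_cell T (a w x y)))
          [a (u \<otimes>\<^bsub>T\<^esub> v) (w \<otimes>\<^bsub>T\<^esub> x) y, a (u \<otimes>\<^bsub>T\<^esub> v) w x \<odot>\<^bsub>T\<^esub> i y],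
        W [a u v (w \<otimes>\<^bsub>T\<^esub> (x \<otimes>\<^bsub>T\<^esub> y))] (pi_cell T (u \<otimes>\<^bsub>T\<^esub> v) w x y) []]
     = paste (hom_of T X)
       [W [i u \<odot>\<^bsub>T\<^esub> (i v \<odot>\<^bsub>T\<^esub> a w x y), i u \<odot>\<^bsub>T\<^esub> a v (w \<otimes>\<^bsub>T\<^esub> x) y]
          (as_nat T (i u) (a v w x) (i y))
          [a u (v \<otimes>\<^bsub>T\<^esub> w) x \<odot>\<^bsub>T\<^esub> i y, (a u v w \<odot>\<^bsub>T\<^esub> i x) \<odot>\<^bsub>T\<^esub> i y],
        W [] (lwhisk T u (((v \<otimes>\<^bsub>T\<^esub> w) \<otimes>\<^bsub>T\<^esub> x) \<otimes>\<^bsub>T\<^esub> y) (pi_cell T v w x y))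
          [a u ((v \<otimes>\<^bsub>T\<^esub> w) \<otimes>\<^bsub>T\<^esub> x) y, a u (v \<otimes>\<^bsub>T\<^esub> w) x \<odot>\<^bsub>T\<^esub> i y, (a u v w \<odot>\<^bsub>T\<^esub> i x) \<odot>\<^bsub>T\<^esub> i y],
        W [i u \<odot>\<^bsub>T\<^esub> a v w (x \<otimes>\<^bsub>T\<^esub> y)]
          (pi_cell T u (v \<otimes>\<^bsub>T\<^esub> w) x y)
          [(a u v w \<odot>\<^bsub>T\<^esub> i x) \<odot>\<^bsub>T\<^esub> i y],
        W [i u \<odot>\<^bsub>T\<^esub> a v w (x \<otimes>\<^bsub>T\<^esub> y), a u (v \<otimes>\<^bsub>T\<^esub> w) (x \<otimes>\<^bsub>T\<^esub> y)]
          (as_nat T (a u v w) (i x) (i y))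
          [],
        V [i u \<odot>\<^bsub>T\<^esub> a v w (x \<otimes>\<^bsub>T\<^esub> y), a u (v \<otimes>\<^bsub>T\<^esub> w) (x \<otimes>\<^bsub>T\<^esub> y)]
          (tens2 T (id_cell T (a u v w)) (ten_unit T x y))
          [a ((u \<otimes>\<^bsub>T\<^esub> v) \<otimes>\<^bsub>T\<^esub> w) x y],
        W [] (pi_cell T u v w (x \<otimes>\<^bsub>T\<^esub> y)) [a ((u \<otimes>\<^bsub>T\<^esub> v) \<otimes>\<^bsub>T\<^esub> w) x y]])"

text \<open>The left and right normalization axioms.\<close>

definition left_unit_axiom ::
  "('o, 'f, 'x, 'm) tricat \<Rightarrow> ('o, 'f) tg \<Rightarrow> ('o, 'f) tg \<Rightarrow> ('o, 'f) tg \<Rightarrow> bool" where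
  "left_unit_axiom T x y z \<longleftrightarrow>
    (let X = (x \<otimes>\<^bsub>T\<^esub> y) \<otimes>\<^bsub>T\<^esub> z; W = forward T X; V = backward T X; i = idc T; a = as1 T; I = unit_trg T y in
     paste (hom_of T X)
       [W [] (lwhisk T x ((I \<otimes>\<^bsub>T\<^esub> y) \<otimes>\<^bsub>T\<^esub> z) (lam_cell T y z))
          [a x (I \<otimes>\<^bsub>T\<^esub> y) z, a x I y \<odot>\<^bsub>T\<^esub> i z, (rd1 T x \<odot>\<^bsub>T\<^esub> i y) \<odot>\<^bsub>T\<^esub> i z],
        W [i x \<odot>\<^bsub>T\<^esub> lf1 T (y \<otimes>\<^bsub>T\<^esub> z)]
          (pi_cell T x I y z)
          [(rd1 T x \<odot>\<^bsub>T\<^esub> i y) \<odot>\<^bsub>T\<^esub> i z],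
        W [i x \<odot>\<^bsub>T\<^esub> lf1 T (y \<otimes>\<^bsub>T\<^esub> z), a x I (y \<otimes>\<^bsub>T\<^esub> z)]
          (as_nat T (rd1 T x) (i y) (i z))
          [],
        V [i x \<odot>\<^bsub>T\<^esub> lf1 T (y \<otimes>\<^bsub>T\<^esub> z), a x I (y \<otimes>\<^bsub>T\<^esub> z)]
          (tens2 T (id_cell T (rd1 T x)) (ten_unit T y z))
          [a x y z],
        W [] (mu_cell T x (y \<otimes>\<^bsub>T\<^esub> z)) [a x y z]]
     = paste (hom_of T X)
       [V [] (as_nat T (i x) (lf1 T y) (i z))
          [a x I y \<odot>\<^bsub>T\<^esub> i z, (rd1 T x \<odot>\<^bsub>T\<^esub> i y) \<odot>\<^bsub>T\<^esub> i z],
        W [a x y z] (rwhisk T (x \<otimes>\<^bsub>T\<^esub> y) (mu_cell T x y) z) []])"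

definition right_unit_axiom ::
  "('o, 'f, 'x, 'm) tricat \<Rightarrow> ('o, 'f) tg \<Rightarrow> ('o, 'f) tg \<Rightarrow> ('o, 'f) tg \<Rightarrow> bool" where
  "right_unit_axiom T x y z \<longleftrightarrow>
    (let X = (x \<otimes>\<^bsub>T\<^esub> y) \<otimes>\<^bsub>T\<^esub> z; W = forward T X; V = backward T X; i = idc T; a = as1 T; I = unit_src T y in
     paste (hom_of T X)
       [W [i x \<odot>\<^bsub>T\<^esub> (i y \<odot>\<^bsub>T\<^esub> lf1 T z), i x \<odot>\<^bsub>T\<^esub> a y I z, a x (y \<otimes>\<^bsub>T\<^esub> I) z]
          (rwhisk T (x \<otimes>\<^bsub>T\<^esub> y) (rho_cell T x y) z)
          [],
        W [i x \<odot>\<^bsub>T\<^esub> (i y \<odot>\<^bsub>T\<^esub> lf1 T z)]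
          (pi_cell T x y I z)
          [rd1 T (x \<otimes>\<^bsub>T\<^esub> y) \<odot>\<^bsub>T\<^esub> i z],
        V [] (as_nat T (i x) (i y) (lf1 T z))
          [a (x \<otimes>\<^bsub>T\<^esub> y) I z, rd1 T (x \<otimes>\<^bsub>T\<^esub> y) \<odot>\<^bsub>T\<^esub> i z],
        V [a x y z]
          (tens2 T (ten_unit T x y) (id_cell T (lf1 T z)))
          [a (x \<otimes>\<^bsub>T\<^esub> y) I z, rd1 T (x \<otimes>\<^bsub>T\<^esub> y) \<odot>\<^bsub>T\<^esub> i z],
        W [a x y z] (mu_cell T (x \<otimes>\<^bsub>T\<^esub> y) z) []]
     = paste (hom_of T X)
       [W [i x \<odot>\<^bsub>T\<^esub> (i y \<odot>\<^bsub>T\<^esub> lf1 T z), i x \<odot>\<^bsub>T\<^esub> a y I z]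
          (as_nat T (i x) (rd1 T y) (i z))
          [],
        W [] (lwhisk T x (y \<otimes>\<^bsub>T\<^esub> z) (mu_cell T y z)) [a x y z]])"

locale tricategory =
  fixes T :: "('o, 'f, 'x, 'm) tricat"
  assumes hom_bicat: "\<lbrakk>a \<in> T0 T; b \<in> T0 T\<rbrakk> \<Longrightarrow> bicategory (Hom T a b)"
    and ten_psf: "\<lbrakk>a \<in> T0 T; b \<in> T0 T; c \<in> T0 T\<rbrakk> \<Longrightarrow>
        pseudofunctor (ten T a b c)
        \<and> fsrc (ten T a b c) = prod_bicat (Hom T b c) (Hom T a b) \<and> ftrg (ten T a b c) = Hom T a c"
    and uni_psf: "a \<in> T0 T \<Longrightarrow>
        pseudofunctor (uni T a) \<and> fsrc (uni T a) = terminal_bicat \<and> ftrg (uni T a) = Hom T a a"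
    and ass_adj: "\<lbrakk>a \<in> T0 T; b \<in> T0 T; c \<in> T0 T; d \<in> T0 T\<rbrakk> \<Longrightarrow>
        let A = Hom T a b; B = Hom T b c; C = Hom T c d;
            h = psf_fst C (prod_bicat B A);
            g = psf_comp (psf_fst B A) (psf_snd C (prod_bicat B A));
            f = psf_comp (psf_snd B A) (psf_snd C (prod_bicat B A))
        in adjoint_equivalence (ass T a b c d)
             (tenF T a b d (tenF T b c d h g) f) (tenF T a c d h (tenF T a b c g f))"
    and lft_adj: "\<lbrakk>a \<in> T0 T; b \<in> T0 T\<rbrakk> \<Longrightarrow>
        adjoint_equivalence (lft T a b)
          (tenF T a b b (unitF T (Hom T a b) b) (psf_id (Hom T a b))) (psf_id (Hom T a b))"
    and rgt_adj: "\<lbrakk>a \<in> T0 T; b \<in> T0 T\<rbrakk> \<Longrightarrow>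
        adjoint_equivalence (rgt T a b)
          (tenF T a a b (psf_id (Hom T a b)) (unitF T (Hom T a b) a)) (psf_id (Hom T a b))"
    and pi_mod: "\<lbrakk>a \<in> T0 T; b \<in> T0 T; c \<in> T0 T; d \<in> T0 T; e \<in> T0 T\<rbrakk> \<Longrightarrow>
        let A = Hom T a b; B = Hom T b c; C = Hom T c d; D = Hom T d e;
            BA = prod_bicat B A; CBA = prod_bicat C BA;
            w = psf_fst D CBA;
            x = psf_comp (psf_fst C BA) (psf_snd D CBA);
            y = psf_comp (psf_fst B A) (psf_comp (psf_snd C BA) (psf_snd D CBA));
            z = psf_comp (psf_snd B A) (psf_comp (psf_snd C BA) (psf_snd D CBA))
        in invertible_modification (pi_src T a b c d e w x y z) (pi_trg T a b c d e w x y z)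
             (tpi T a b c d e)"
    and mu_mod: "\<lbrakk>a \<in> T0 T; b \<in> T0 T; c \<in> T0 T\<rbrakk> \<Longrightarrow>
        let x = psf_fst (Hom T b c) (Hom T a b); y = psf_snd (Hom T b c) (Hom T a b)
        in invertible_modification (mu_src T a b c x y) (tr_id (tenF T a b c x y)) (tmu T a b c)"
    and lam_mod: "\<lbrakk>a \<in> T0 T; b \<in> T0 T; c \<in> T0 T\<rbrakk> \<Longrightarrow>
        let x = psf_fst (Hom T b c) (Hom T a b); y = psf_snd (Hom T b c) (Hom T a b)
        in invertible_modification (lam_src T a b c x y) (lam_trg T a b c x y) (tlam T a b c)"
    and rho_mod: "\<lbrakk>a \<in> T0 T; b \<in> T0 T; c \<in> T0 T\<rbrakk> \<Longrightarrow>
        let x = psf_fst (Hom T b c) (Hom T a b); y = psf_snd (Hom T b c) (Hom T a b)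
        in invertible_modification (rho_src T a b c x y) (rho_trg T a b c x y) (trho T a b c)"
    and cocycle: "\<lbrakk>a \<in> T0 T; b \<in> T0 T; c \<in> T0 T; d \<in> T0 T; e \<in> T0 T; f \<in> T0 T;
          u \<in> Ob (Hom T e f); v \<in> Ob (Hom T d e); w \<in> Ob (Hom T c d); x \<in> Ob (Hom T b c);
          y \<in> Ob (Hom T a b)\<rbrakk>
        \<Longrightarrow> cocycle_axiom T (e, f, u) (d, e, v) (c, d, w) (b, c, x) (a, b, y)"
    and left_unit: "\<lbrakk>a \<in> T0 T; b \<in> T0 T; c \<in> T0 T; d \<in> T0 T;
          x \<in> Ob (Hom T c d); y \<in> Ob (Hom T b c); z \<in> Ob (Hom T a b)\<rbrakk>
        \<Longrightarrow> left_unit_axiom T (c, d, x) (b, c, y) (a, b, z)"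
    and right_unit: "\<lbrakk>a \<in> T0 T; b \<in> T0 T; c \<in> T0 T; d \<in> T0 T;
          x \<in> Ob (Hom T c d); y \<in> Ob (Hom T b c); z \<in> Ob (Hom T a b)\<rbrakk>
        \<Longrightarrow> right_unit_axiom T (c, d, x) (b, c, y) (a, b, z)"

definition doubly_degenerate :: "('o, 'f, 'x, 'm) tricat \<Rightarrow> bool" where
  "doubly_degenerate T \<longleftrightarrow> (\<exists>a f. T0 T = {a} \<and> Ob (Hom T a a) = {f})"


section \<open>Weak functors of tricategories\<close>

text \<open>The components of \<open>chi\<close> are \<open>Hg \<otimes> Hf \<rightarrow> H(g \<otimes> f)\<close>, the component of \<open>iota\<close> at
  \<open>a\<close> is \<open>I \<rightarrow> H(I)\<close>.\<close>

record ('o, 'f, 'x, 'm, 'p, 'g, 'y, 'n) trifun =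
  h0 :: "'o \<Rightarrow> 'p"
  hloc :: "'o \<Rightarrow> 'o \<Rightarrow> ('f, 'x, 'm, 'g, 'y, 'n) psf"
  chi :: "'o \<Rightarrow> 'o \<Rightarrow> 'o \<Rightarrow> ('f \<times> 'f, 'x \<times> 'x, 'm \<times> 'm, 'g, 'y, 'n) adj"
  iota :: "'o \<Rightarrow> (unit, unit, unit, 'g, 'y, 'n) adj"
  omega :: "'o \<Rightarrow> 'o \<Rightarrow> 'o \<Rightarrow> 'o \<Rightarrow> 'f \<times> 'f \<times> 'f \<Rightarrow> 'n"
  gamma :: "'o \<Rightarrow> 'o \<Rightarrow> 'f \<Rightarrow> 'n"
  delta :: "'o \<Rightarrow> 'o \<Rightarrow> 'f \<Rightarrow> 'n"

definition chiT where
  "chiT H a b c G F = tr_whisker_right (fwd (chi H a b c)) (psf_pair G F)"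

definition iotaT where
  "iotaT H B a = tr_whisker_right (fwd (iota H a)) (psf_bang B)"

definition omega_src where
  "omega_src S T H a b c d x y z =
     tr_comp (tr_whisker_left (hloc H a d) (assT S a b c d x y z))
       (tr_comp (chiT H a b d (tenF S b c d x y) z)
         (tenT T (h0 H a) (h0 H b) (h0 H d) (chiT H b c d x y) (tr_id (psf_comp (hloc H a b) z))))"

definition omega_trg where
  "omega_trg S T H a b c d x y z =
     tr_comp (chiT H a c d x (tenF S a b c y z))
       (tr_comp (tenT T (h0 H a) (h0 H c) (h0 H d) (tr_id (psf_comp (hloc H c d) x)) (chiT H a b c y z))
         (assT T (h0 H a) (h0 H b) (h0 H c) (h0 H d)
           (psf_comp (hloc H c d) x) (psf_comp (hloc H b c) y) (psf_comp (hloc H a b) z)))"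

definition gamma_src where
  "gamma_src S T H a b =
     (let A = Hom S a b in
      tr_comp (tr_whisker_left (hloc H a b) (fwd (lft S a b)))
        (tr_comp (chiT H a b b (unitF S A b) (psf_id A))
          (tenT T (h0 H a) (h0 H b) (h0 H b) (iotaT H A b) (tr_id (hloc H a b)))))"

definition gamma_trg where
  "gamma_trg T H a b = tr_whisker_right (fwd (lft T (h0 H a) (h0 H b))) (hloc H a b)"

definition delta_src where
  "delta_src S H a b = tr_whisker_left (hloc H a b) (bwd (rgt S a b))"

definition delta_trg where
  "delta_trg S T H a b =
     (let A = Hom S a b in
      tr_comp (chiT H a a b (psf_id A) (unitF S A a))
        (tr_comp (tenT T (h0 H a) (h0 H a) (h0 H b) (tr_id (hloc H a b)) (iotaT H A a))
          (tr_whisker_right (bwd (rgt T (h0 H a) (h0 H b))) (hloc H a b))))"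

text \<open>Components with their boundaries, as for tricategories.\<close>

definition ap0 :: "('o, 'f, 'x, 'm, 'p, 'g, 'y, 'n) trifun \<Rightarrow> ('o, 'f) tg \<Rightarrow> ('p, 'g) tg" where
  "ap0 H = (\<lambda>(a, b, f). (h0 H a, h0 H b, f0 (hloc H a b) f))"

definition ap1 :: "('o, 'f, 'x, 'm, 'p, 'g, 'y, 'n) trifun \<Rightarrow> ('o, 'x) tg \<Rightarrow> ('p, 'y) tg" where
  "ap1 H = (\<lambda>(a, b, x). (h0 H a, h0 H b, f1 (hloc H a b) x))"

definition ap_cell ::
  "('o, 'f, 'x, 'm, 'p, 'g, 'y, 'n) trifun \<Rightarrow> ('o, 'f) tg \<Rightarrow> (('o, 'x) tg, 'm) bcell
   \<Rightarrow> (('p, 'y) tg, 'n) bcell" where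
  "ap_cell H = (\<lambda>(a, b, X) (s, \<alpha>, t).
     let (s', \<alpha>', t') = psf_image (hloc H a b) X (map cell_of s, \<alpha>, map cell_of t)
     in (map (\<lambda>x. (h0 H a, h0 H b, x)) s', \<alpha>', map (\<lambda>x. (h0 H a, h0 H b, x)) t'))"

definition ap_unit ::
  "('o, 'f, 'x, 'm) tricat \<Rightarrow> ('p, 'g, 'y, 'n) tricat \<Rightarrow> ('o, 'f, 'x, 'm, 'p, 'g, 'y, 'n) trifun
   \<Rightarrow> ('o, 'f) tg \<Rightarrow> (('p, 'y) tg, 'n) bcell" where
  "ap_unit S T H f =
     ([idc T (ap0 H f)], (case f of (a, b, f') \<Rightarrow> funt (hloc H a b) f'), [ap1 H (idc S f)])"

definition chi1 ::
  "('o, 'f, 'x, 'm, 'p, 'g, 'y, 'n) trifun \<Rightarrow> ('o, 'f) tg \<Rightarrow> ('o, 'f) tg \<Rightarrow> ('p, 'y) tg" where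
  "chi1 H = (\<lambda>(b, c, g) (a, _, f). (h0 H a, h0 H c, tc (fwd (chi H a b c)) (g, f)))"

text \<open>The components of \<open>\<iota>\<close> at the source and at the target 0-cell of a cell.\<close>

definition iota_src ::
  "('o, 'f, 'x, 'm, 'p, 'g, 'y, 'n) trifun \<Rightarrow> ('o, 'z) tg \<Rightarrow> ('p, 'y) tg" where
  "iota_src H = (\<lambda>(a, b, _). (h0 H a, h0 H a, tc (fwd (iota H a)) ()))"

definition iota_trg ::
  "('o, 'f, 'x, 'm, 'p, 'g, 'y, 'n) trifun \<Rightarrow> ('o, 'z) tg \<Rightarrow> ('p, 'y) tg" where
  "iota_trg H = (\<lambda>(a, b, _). (h0 H b, h0 H b, tc (fwd (iota H b)) ()))"

definition chi_nat ::
  "('o, 'f, 'x, 'm) tricat \<Rightarrow> ('p, 'g, 'y, 'n) tricat \<Rightarrow> ('o, 'f, 'x, 'm, 'p, 'g, 'y, 'n) trifun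
   \<Rightarrow> ('o, 'x) tg \<Rightarrow> ('o, 'x) tg \<Rightarrow> (('p, 'y) tg, 'n) bcell" where
  "chi_nat S T H y x =
     ([chi1 H (trg1 S y) (trg1 S x), ap1 H y \<odot>\<^bsub>T\<^esub> ap1 H x],
      (case (y, x) of ((b, c, y'), (a, _, x')) \<Rightarrow> tn (fwd (chi H a b c)) (y', x')),
      [ap1 H (y \<odot>\<^bsub>S\<^esub> x), chi1 H (src1 S y) (src1 S x)])"

definition omega_cell ::
  "('o, 'f, 'x, 'm) tricat \<Rightarrow> ('p, 'g, 'y, 'n) tricat \<Rightarrow> ('o, 'f, 'x, 'm, 'p, 'g, 'y, 'n) trifun
   \<Rightarrow> ('o, 'f) tg \<Rightarrow> ('o, 'f) tg \<Rightarrow> ('o, 'f) tg \<Rightarrow> (('p, 'y) tg, 'n) bcell" where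
  "omega_cell S T H x y z =
     ([ap1 H (as1 S x y z), chi1 H (x \<otimes>\<^bsub>S\<^esub> y) z, chi1 H x y \<odot>\<^bsub>T\<^esub> idc T (ap0 H z)],
      (case (x, y, z) of ((c, d, x'), (b, _, y'), (a, _, z')) \<Rightarrow> omega H a b c d (x', y', z')),
      [chi1 H x (y \<otimes>\<^bsub>S\<^esub> z), idc T (ap0 H x) \<odot>\<^bsub>T\<^esub> chi1 H y z, as1 T (ap0 H x) (ap0 H y) (ap0 H z)])"

definition gamma_cell ::
  "('o, 'f, 'x, 'm) tricat \<Rightarrow> ('p, 'g, 'y, 'n) tricat \<Rightarrow> ('o, 'f, 'x, 'm, 'p, 'g, 'y, 'n) trifun
   \<Rightarrow> ('o, 'f) tg \<Rightarrow> (('p, 'y) tg, 'n) bcell" where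
  "gamma_cell S T H f =
     ([ap1 H (lf1 S f), chi1 H (unit_trg S f) f, iota_trg H f \<odot>\<^bsub>T\<^esub> idc T (ap0 H f)],
      (case f of (a, b, f') \<Rightarrow> gamma H a b f'),
      [lf1 T (ap0 H f)])"

definition delta_cell ::
  "('o, 'f, 'x, 'm) tricat \<Rightarrow> ('p, 'g, 'y, 'n) tricat \<Rightarrow> ('o, 'f, 'x, 'm, 'p, 'g, 'y, 'n) trifun
   \<Rightarrow> ('o, 'f) tg \<Rightarrow> (('p, 'y) tg, 'n) bcell" where
  "delta_cell S T H f =
     ([ap1 H (rd1 S f)],
      (case f of (a, b, f') \<Rightarrow> delta H a b f'),
      [chi1 H f (unit_src S f), idc T (ap0 H f) \<odot>\<^bsub>T\<^esub> iota_src H f, rd1 T (ap0 H f)])"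

definition trifun_assoc_axiom ::
  "('o, 'f, 'x, 'm) tricat \<Rightarrow> ('p, 'g, 'y, 'n) tricat \<Rightarrow> ('o, 'f, 'x, 'm, 'p, 'g, 'y, 'n) trifun
   \<Rightarrow> ('o, 'f) tg \<Rightarrow> ('o, 'f) tg \<Rightarrow> ('o, 'f) tg \<Rightarrow> ('o, 'f) tg \<Rightarrow> bool" where
  "trifun_assoc_axiom S T H w x y z \<longleftrightarrow>
    (let w' = ap0 H w; x' = ap0 H x; y' = ap0 H y; z' = ap0 H z;
         X = ((w' \<otimes>\<^bsub>T\<^esub> x') \<otimes>\<^bsub>T\<^esub> y') \<otimes>\<^bsub>T\<^esub> z'; W = forward T X; V = backward T X;
         h = ap1 H; \<chi> = chi1 H; i = idc S; a = as1 S; i' = idc T; a' = as1 T in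
     paste (hom_of T X)
       [W [] (ap_cell H (((w \<otimes>\<^bsub>S\<^esub> x) \<otimes>\<^bsub>S\<^esub> y) \<otimes>\<^bsub>S\<^esub> z) (pi_cell S w x y z))
          [\<chi> ((w \<otimes>\<^bsub>S\<^esub> x) \<otimes>\<^bsub>S\<^esub> y) z, \<chi> (w \<otimes>\<^bsub>S\<^esub> x) y \<odot>\<^bsub>T\<^esub> i' z', (\<chi> w x \<odot>\<^bsub>T\<^esub> i' y') \<odot>\<^bsub>T\<^esub> i' z'],
        W [h (a w x (y \<otimes>\<^bsub>S\<^esub> z))]
          (omega_cell S T H (w \<otimes>\<^bsub>S\<^esub> x) y z)
          [(\<chi> w x \<odot>\<^bsub>T\<^esub> i' y') \<odot>\<^bsub>T\<^esub> i' z'],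
        W [h (a w x (y \<otimes>\<^bsub>S\<^esub> z)), \<chi> (w \<otimes>\<^bsub>S\<^esub> x) (y \<otimes>\<^bsub>S\<^esub> z), i' (ap0 H (w \<otimes>\<^bsub>S\<^esub> x)) \<odot>\<^bsub>T\<^esub> \<chi> y z]
          (as_nat T (\<chi> w x) (i' y') (i' z'))
          [],
        V [h (a w x (y \<otimes>\<^bsub>S\<^esub> z)), \<chi> (w \<otimes>\<^bsub>S\<^esub> x) (y \<otimes>\<^bsub>S\<^esub> z), i' (ap0 H (w \<otimes>\<^bsub>S\<^esub> x)) \<odot>\<^bsub>T\<^esub> \<chi> y z]
          (tens2 T (id_cell T (\<chi> w x)) (ten_unit T y' z'))
          [a' (w' \<otimes>\<^bsub>T\<^esub> x') y' z'],
        W [h (a w x (y \<otimes>\<^bsub>S\<^esub> z)), \<chi> (w \<otimes>\<^bsub>S\<^esub> x) (y \<otimes>\<^bsub>S\<^esub> z)]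
          (ten_swap T (\<chi> w x) (\<chi> y z))
          [a' (w' \<otimes>\<^bsub>T\<^esub> x') y' z'],
        W [] (omega_cell S T H w x (y \<otimes>\<^bsub>S\<^esub> z))
          [i' (w' \<otimes>\<^bsub>T\<^esub> x') \<odot>\<^bsub>T\<^esub> \<chi> y z, a' (w' \<otimes>\<^bsub>T\<^esub> x') y' z'],
        W [\<chi> w (x \<otimes>\<^bsub>S\<^esub> (y \<otimes>\<^bsub>S\<^esub> z)), i' w' \<odot>\<^bsub>T\<^esub> \<chi> x (y \<otimes>\<^bsub>S\<^esub> z), a' w' x' (ap0 H (y \<otimes>\<^bsub>S\<^esub> z))]
          (tens2 T (ten_unit T w' x') (id_cell T (\<chi> y z)))
          [a' (w' \<otimes>\<^bsub>T\<^esub> x') y' z'],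
        W [\<chi> w (x \<otimes>\<^bsub>S\<^esub> (y \<otimes>\<^bsub>S\<^esub> z)), i' w' \<odot>\<^bsub>T\<^esub> \<chi> x (y \<otimes>\<^bsub>S\<^esub> z)]
          (as_nat T (i' w') (i' x') (\<chi> y z))
          [a' (w' \<otimes>\<^bsub>T\<^esub> x') y' z']]
     = paste (hom_of T X)
       [V [h (i w \<odot>\<^bsub>S\<^esub> a x y z), h (a w (x \<otimes>\<^bsub>S\<^esub> y) z)]
          (chi_nat S T H (a w x y) (i z))
          [\<chi> (w \<otimes>\<^bsub>S\<^esub> x) y \<odot>\<^bsub>T\<^esub> i' z', (\<chi> w x \<odot>\<^bsub>T\<^esub> i' y') \<odot>\<^bsub>T\<^esub> i' z'],
        V [h (i w \<odot>\<^bsub>S\<^esub> a x y z), h (a w (x \<otimes>\<^bsub>S\<^esub> y) z), \<chi> (w \<otimes>\<^bsub>S\<^esub> (x \<otimes>\<^bsub>S\<^esub> y)) z]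
          (tens2 T (id_cell T (h (a w x y))) (ap_unit S T H z))
          [\<chi> (w \<otimes>\<^bsub>S\<^esub> x) y \<odot>\<^bsub>T\<^esub> i' z', (\<chi> w x \<odot>\<^bsub>T\<^esub> i' y') \<odot>\<^bsub>T\<^esub> i' z'],
        W [h (i w \<odot>\<^bsub>S\<^esub> a x y z), h (a w (x \<otimes>\<^bsub>S\<^esub> y) z), \<chi> (w \<otimes>\<^bsub>S\<^esub> (x \<otimes>\<^bsub>S\<^esub> y)) z]
          (rwhisk T ((w' \<otimes>\<^bsub>T\<^esub> x') \<otimes>\<^bsub>T\<^esub> y') (omega_cell S T H w x y) z')
          [],
        W [h (i w \<odot>\<^bsub>S\<^esub> a x y z)]
          (omega_cell S T H w (x \<otimes>\<^bsub>S\<^esub> y) z)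
          [(i' w' \<odot>\<^bsub>T\<^esub> \<chi> x y) \<odot>\<^bsub>T\<^esub> i' z', a' w' x' y' \<odot>\<^bsub>T\<^esub> i' z'],
        V [] (chi_nat S T H (i w) (a x y z))
          [i' w' \<odot>\<^bsub>T\<^esub> \<chi> (x \<otimes>\<^bsub>S\<^esub> y) z, a' w' (ap0 H (x \<otimes>\<^bsub>S\<^esub> y)) z', (i' w' \<odot>\<^bsub>T\<^esub> \<chi> x y) \<odot>\<^bsub>T\<^esub> i' z',
           a' w' x' y' \<odot>\<^bsub>T\<^esub> i' z'],
        V [\<chi> w (x \<otimes>\<^bsub>S\<^esub> (y \<otimes>\<^bsub>S\<^esub> z))]
          (tens2 T (ap_unit S T H w) (id_cell T (h (a x y z))))
          [i' w' \<odot>\<^bsub>T\<^esub> \<chi> (x \<otimes>\<^bsub>S\<^esub> y) z, a' w' (ap0 H (x \<otimes>\<^bsub>S\<^esub> y)) z', (i' w' \<odot>\<^bsub>T\<^esub> \<chi> x y) \<odot>\<^bsub>T\<^esub> i' z',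
           a' w' x' y' \<odot>\<^bsub>T\<^esub> i' z'],
        W [\<chi> w (x \<otimes>\<^bsub>S\<^esub> (y \<otimes>\<^bsub>S\<^esub> z)), i' w' \<odot>\<^bsub>T\<^esub> h (a x y z), i' w' \<odot>\<^bsub>T\<^esub> \<chi> (x \<otimes>\<^bsub>S\<^esub> y) z]
          (as_nat T (i' w') (\<chi> x y) (i' z'))
          [a' w' x' y' \<odot>\<^bsub>T\<^esub> i' z'],
        W [\<chi> w (x \<otimes>\<^bsub>S\<^esub> (y \<otimes>\<^bsub>S\<^esub> z))]
          (lwhisk T w' ((x' \<otimes>\<^bsub>T\<^esub> y') \<otimes>\<^bsub>T\<^esub> z') (omega_cell S T H x y z))
          [a' w' (x' \<otimes>\<^bsub>T\<^esub> y') z', a' w' x' y' \<odot>\<^bsub>T\<^esub> i' z'],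
        W [\<chi> w (x \<otimes>\<^bsub>S\<^esub> (y \<otimes>\<^bsub>S\<^esub> z)), i' w' \<odot>\<^bsub>T\<^esub> \<chi> x (y \<otimes>\<^bsub>S\<^esub> z), i' w' \<odot>\<^bsub>T\<^esub> (i' x' \<odot>\<^bsub>T\<^esub> \<chi> y z)]
          (pi_cell T w' x' y' z')
          []])"

definition trifun_unit_axiom ::
  "('o, 'f, 'x, 'm) tricat \<Rightarrow> ('p, 'g, 'y, 'n) tricat \<Rightarrow> ('o, 'f, 'x, 'm, 'p, 'g, 'y, 'n) trifun
   \<Rightarrow> ('o, 'f) tg \<Rightarrow> ('o, 'f) tg \<Rightarrow> bool" where
  "trifun_unit_axiom S T H x y \<longleftrightarrow>
    (let x' = ap0 H x; y' = ap0 H y; X = x' \<otimes>\<^bsub>T\<^esub> y'; W = forward T X; V = backward T X;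
         h = ap1 H; \<chi> = chi1 H; i = idc S; a = as1 S; i' = idc T; a' = as1 T;
         I = unit_trg S y; I' = unit_trg T y'; \<iota> = iota_trg H y in
     paste (hom_of T X)
       [W [] (ap_cell H (x \<otimes>\<^bsub>S\<^esub> y) (mu_cell S x y)) [\<chi> x y]]
     = paste (hom_of T X)
       [V [h (i x \<odot>\<^bsub>S\<^esub> lf1 S y), h (a x I y)]
          (chi_nat S T H (rd1 S x) (i y))
          [],
        V [h (i x \<odot>\<^bsub>S\<^esub> lf1 S y), h (a x I y), \<chi> (x \<otimes>\<^bsub>S\<^esub> I) y]
          (tens2 T (id_cell T (h (rd1 S x))) (ap_unit S T H y))
          [],
        W [h (i x \<odot>\<^bsub>S\<^esub> lf1 S y), h (a x I y), \<chi> (x \<otimes>\<^bsub>S\<^esub> I) y]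
          (rwhisk T x' (delta_cell S T H x) y')
          [],
        W [h (i x \<odot>\<^bsub>S\<^esub> lf1 S y)]
          (omega_cell S T H x I y)
          [(i' x' \<odot>\<^bsub>T\<^esub> \<iota>) \<odot>\<^bsub>T\<^esub> i' y', rd1 T x' \<odot>\<^bsub>T\<^esub> i' y'],
        W [h (i x \<odot>\<^bsub>S\<^esub> lf1 S y), \<chi> x (I \<otimes>\<^bsub>S\<^esub> y), i' x' \<odot>\<^bsub>T\<^esub> \<chi> I y]
          (as_nat T (i' x') \<iota> (i' y'))
          [rd1 T x' \<odot>\<^bsub>T\<^esub> i' y'],
        V [] (chi_nat S T H (i x) (lf1 S y))
          [i' x' \<odot>\<^bsub>T\<^esub> \<chi> I y, i' x' \<odot>\<^bsub>T\<^esub> (\<iota> \<odot>\<^bsub>T\<^esub> i' y'), a' x' I' y', rd1 T x' \<odot>\<^bsub>T\<^esub> i' y'],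
        V [\<chi> x y]
          (tens2 T (ap_unit S T H x) (id_cell T (h (lf1 S y))))
          [i' x' \<odot>\<^bsub>T\<^esub> \<chi> I y, i' x' \<odot>\<^bsub>T\<^esub> (\<iota> \<odot>\<^bsub>T\<^esub> i' y'), a' x' I' y', rd1 T x' \<odot>\<^bsub>T\<^esub> i' y'],
        W [\<chi> x y]
          (lwhisk T x' (I' \<otimes>\<^bsub>T\<^esub> y') (gamma_cell S T H y))
          [a' x' I' y', rd1 T x' \<odot>\<^bsub>T\<^esub> i' y'],
        W [\<chi> x y] (mu_cell T x' y') []])"

locale trifunctor =
  fixes S :: "('o, 'f, 'x, 'm) tricat" and T :: "('p, 'g, 'y, 'n) tricat"
    and H :: "('o, 'f, 'x, 'm, 'p, 'g, 'y, 'n) trifun"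
  assumes src_tricat: "tricategory S" and trg_tricat: "tricategory T"
    and h0_T0: "a \<in> T0 S \<Longrightarrow> h0 H a \<in> T0 T"
    and hloc_psf: "\<lbrakk>a \<in> T0 S; b \<in> T0 S\<rbrakk> \<Longrightarrow>
        pseudofunctor (hloc H a b)
        \<and> fsrc (hloc H a b) = Hom S a b \<and> ftrg (hloc H a b) = Hom T (h0 H a) (h0 H b)"
    and chi_adj: "\<lbrakk>a \<in> T0 S; b \<in> T0 S; c \<in> T0 S\<rbrakk> \<Longrightarrow>
        let g = psf_fst (Hom S b c) (Hom S a b); f = psf_snd (Hom S b c) (Hom S a b)
        in adjoint_equivalence (chi H a b c)
             (tenF T (h0 H a) (h0 H b) (h0 H c) (psf_comp (hloc H b c) g) (psf_comp (hloc H a b) f))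
             (psf_comp (hloc H a c) (ten S a b c))"
    and iota_adj: "a \<in> T0 S \<Longrightarrow>
        adjoint_equivalence (iota H a) (uni T (h0 H a)) (psf_comp (hloc H a a) (uni S a))"
    and omega_mod: "\<lbrakk>a \<in> T0 S; b \<in> T0 S; c \<in> T0 S; d \<in> T0 S\<rbrakk> \<Longrightarrow>
        let A = Hom S a b; B = Hom S b c; C = Hom S c d;
            x = psf_fst C (prod_bicat B A);
            y = psf_comp (psf_fst B A) (psf_snd C (prod_bicat B A));
            z = psf_comp (psf_snd B A) (psf_snd C (prod_bicat B A))
        in invertible_modification (omega_src S T H a b c d x y z) (omega_trg S T H a b c d x y z)
             (omega H a b c d)"
    and gamma_mod: "\<lbrakk>a \<in> T0 S; b \<in> T0 S\<rbrakk> \<Longrightarrow>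
        invertible_modification (gamma_src S T H a b) (gamma_trg T H a b) (gamma H a b)"
    and delta_mod: "\<lbrakk>a \<in> T0 S; b \<in> T0 S\<rbrakk> \<Longrightarrow>
        invertible_modification (delta_src S H a b) (delta_trg S T H a b) (delta H a b)"
    and assoc_axiom: "\<lbrakk>a \<in> T0 S; b \<in> T0 S; c \<in> T0 S; d \<in> T0 S; e \<in> T0 S;
          w \<in> Ob (Hom S d e); x \<in> Ob (Hom S c d); y \<in> Ob (Hom S b c); z \<in> Ob (Hom S a b)\<rbrakk>
        \<Longrightarrow> trifun_assoc_axiom S T H (d, e, w) (c, d, x) (b, c, y) (a, b, z)"
    and unit_axiom: "\<lbrakk>a \<in> T0 S; b \<in> T0 S; c \<in> T0 S; x \<in> Ob (Hom S b c); y \<in> Ob (Hom S a b)\<rbrakk>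
        \<Longrightarrow> trifun_unit_axiom S T H (b, c, x) (a, b, y)"


section \<open>Locally iconic lax transformations\<close>

locale icon =
  fixes F :: "('o, 'a, 'c, 'p, 'b, 'd) psf" and G :: "('o, 'a, 'c, 'p, 'b, 'd) psf"
    and \<alpha> :: "'a \<Rightarrow> 'd"
    and B :: "('o, 'a, 'c) bicat" and C :: "('p, 'b, 'd) bicat"
  defines "B \<equiv> fsrc F" and "C \<equiv> ftrg F"
  assumes F_psf: "pseudofunctor F" and G_psf: "pseudofunctor G"
    and parallel: "fsrc G = B" "ftrg G = C"
    and agree: "X \<in> Ob B \<Longrightarrow> f0 F X = f0 G X"
    and comp_hom2: "f \<in> Arr B \<Longrightarrow> \<alpha> f \<in> hom2 C (f1 F f) (f1 G f)"
    and comp_nat: "\<beta> \<in> hom2 B f g \<Longrightarrow> vc C (\<alpha> g) (f2 F \<beta>) = vc C (f2 G \<beta>) (\<alpha> f)"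
    and comp_mul: "\<lbrakk>f \<in> hom1 B X Y; g \<in> hom1 B Y Z\<rbrakk>
        \<Longrightarrow> vc C (\<alpha> (hc1 B g f)) (fmul F g f) = vc C (fmul G g f) (hc2 C (\<alpha> g) (\<alpha> f))"
    and comp_unt: "X \<in> Ob B \<Longrightarrow> vc C (\<alpha> (id1 B X)) (funt F X) = funt G X"

record ('o, 'f, 'x, 'n) tricon =
  icomp :: "'o \<Rightarrow> 'o \<Rightarrow> 'x \<Rightarrow> 'n"
  iPi :: "'o \<Rightarrow> 'o \<Rightarrow> 'o \<Rightarrow> 'f \<times> 'f \<Rightarrow> 'n"
  iM :: "'o \<Rightarrow> 'n"

definition icon_cell ::
  "('o, 'f, 'x, 'm, 'p, 'g, 'y, 'n) trifun \<Rightarrow> ('o, 'f, 'x, 'm, 'p, 'g, 'y, 'n) trifun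
   \<Rightarrow> ('o, 'f, 'x, 'n) tricon \<Rightarrow> ('o, 'x) tg \<Rightarrow> (('p, 'y) tg, 'n) bcell" where
  "icon_cell H K \<alpha> x = ([ap1 H x], (case x of (a, b, x') \<Rightarrow> icomp \<alpha> a b x'), [ap1 K x])"

definition Pi_cell ::
  "('o, 'f, 'x, 'm, 'p, 'g, 'y, 'n) trifun \<Rightarrow> ('o, 'f, 'x, 'm, 'p, 'g, 'y, 'n) trifun
   \<Rightarrow> ('o, 'f, 'x, 'n) tricon \<Rightarrow> ('o, 'f) tg \<Rightarrow> ('o, 'f) tg \<Rightarrow> (('p, 'y) tg, 'n) bcell" where
  "Pi_cell H K \<alpha> g f =
     ([chi1 K g f], (case (g, f) of ((b, c, g'), (a, _, f')) \<Rightarrow> iPi \<alpha> a b c (g', f')), [chi1 H g f])"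

definition M_src_cell ::
  "('o, 'f, 'x, 'm, 'p, 'g, 'y, 'n) trifun \<Rightarrow> ('o, 'f, 'x, 'm, 'p, 'g, 'y, 'n) trifun
   \<Rightarrow> ('o, 'f, 'x, 'n) tricon \<Rightarrow> ('o, 'z) tg \<Rightarrow> (('p, 'y) tg, 'n) bcell" where
  "M_src_cell H K \<alpha> f = ([iota_src H f], (case f of (a, b, _) \<Rightarrow> iM \<alpha> a), [iota_src K f])"

definition M_trg_cell ::
  "('o, 'f, 'x, 'm, 'p, 'g, 'y, 'n) trifun \<Rightarrow> ('o, 'f, 'x, 'm, 'p, 'g, 'y, 'n) trifun
   \<Rightarrow> ('o, 'f, 'x, 'n) tricon \<Rightarrow> ('o, 'z) tg \<Rightarrow> (('p, 'y) tg, 'n) bcell" where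
  "M_trg_cell H K \<alpha> f = ([iota_trg H f], (case f of (a, b, _) \<Rightarrow> iM \<alpha> b), [iota_trg K f])"

definition tricon_chi_axiom where
  "tricon_chi_axiom S T H K \<alpha> y x \<longleftrightarrow>
    (let X = ap0 H (src1 S y) \<otimes>\<^bsub>T\<^esub> ap0 H (src1 S x); W = forward T X in
     paste (hom_of T X)
       [W [] (Pi_cell H K \<alpha> (trg1 S y) (trg1 S x)) [ap1 H y \<odot>\<^bsub>T\<^esub> ap1 H x],
        W [] (chi_nat S T H y x) [],
        W [] (icon_cell H K \<alpha> (y \<odot>\<^bsub>S\<^esub> x)) [chi1 H (src1 S y) (src1 S x)]]
     = paste (hom_of T X)
       [W [chi1 K (trg1 S y) (trg1 S x)] (tens2 T (icon_cell H K \<alpha> y) (icon_cell H K \<alpha> x)) [],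
        W [] (chi_nat S T K y x) [],
        W [ap1 K (y \<odot>\<^bsub>S\<^esub> x)] (Pi_cell H K \<alpha> (src1 S y) (src1 S x)) []])"

definition tricon_omega_axiom where
  "tricon_omega_axiom S T H K \<alpha> x y z \<longleftrightarrow>
    (let X = (ap0 H x \<otimes>\<^bsub>T\<^esub> ap0 H y) \<otimes>\<^bsub>T\<^esub> ap0 H z; W = forward T X; i' = idc T;
         a' = as1 T (ap0 H x) (ap0 H y) (ap0 H z) in
     paste (hom_of T X)
       [W [ap1 H (as1 S x y z)] (Pi_cell H K \<alpha> (x \<otimes>\<^bsub>S\<^esub> y) z) [chi1 K x y \<odot>\<^bsub>T\<^esub> i' (ap0 H z)],
        W [ap1 H (as1 S x y z), chi1 H (x \<otimes>\<^bsub>S\<^esub> y) z]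
          (tens2 T (Pi_cell H K \<alpha> x y) (id_cell T (i' (ap0 H z))))
          [],
        W [] (omega_cell S T H x y z) []]
     = paste (hom_of T X)
       [W [] (icon_cell H K \<alpha> (as1 S x y z))
          [chi1 K (x \<otimes>\<^bsub>S\<^esub> y) z, chi1 K x y \<odot>\<^bsub>T\<^esub> i' (ap0 H z)],
        W [] (omega_cell S T K x y z) [],
        W [] (Pi_cell H K \<alpha> x (y \<otimes>\<^bsub>S\<^esub> z)) [i' (ap0 H x) \<odot>\<^bsub>T\<^esub> chi1 K y z, a'],
        W [chi1 H x (y \<otimes>\<^bsub>S\<^esub> z)]
          (tens2 T (id_cell T (i' (ap0 H x))) (Pi_cell H K \<alpha> y z))
          [a']])"

definition tricon_gamma_axiom where
  "tricon_gamma_axiom S T H K \<alpha> f \<longleftrightarrow>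
    (let X = unit_trg T (ap0 H f) \<otimes>\<^bsub>T\<^esub> ap0 H f; W = forward T X; i' = idc T (ap0 H f) in
     paste (hom_of T X)
       [W [ap1 H (lf1 S f)] (Pi_cell H K \<alpha> (unit_trg S f) f) [iota_trg H f \<odot>\<^bsub>T\<^esub> i'],
        W [] (gamma_cell S T H f) []]
     = paste (hom_of T X)
       [W [] (icon_cell H K \<alpha> (lf1 S f)) [chi1 K (unit_trg S f) f, iota_trg H f \<odot>\<^bsub>T\<^esub> i'],
        W [ap1 K (lf1 S f), chi1 K (unit_trg S f) f] (tens2 T (M_trg_cell H K \<alpha> f) (id_cell T i')) [],
        W [] (gamma_cell S T K f) []])"

definition tricon_delta_axiom where
  "tricon_delta_axiom S T H K \<alpha> f \<longleftrightarrow>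
    (let X = ap0 H f; W = forward T X; i' = idc T (ap0 H f); r' = rd1 T (ap0 H f) in
     paste (hom_of T X)
       [W [] (delta_cell S T H f) [],
        W [chi1 H f (unit_src S f)] (tens2 T (id_cell T i') (M_src_cell H K \<alpha> f)) [r']]
     = paste (hom_of T X)
       [W [] (icon_cell H K \<alpha> (rd1 S f)) [],
        W [] (delta_cell S T K f) [],
        W [] (Pi_cell H K \<alpha> f (unit_src S f)) [i' \<odot>\<^bsub>T\<^esub> iota_src K f, r']])"

text \<open>
  The 2-cells of the bicategory of tricategories. Since the 1- and 2-cell components are identities,
  \<open>H\<close> and \<open>K\<close> agree on 0- and 1-cells and the 3-cell components form icons. Compatibility of \<open>iM\<close>
  with the naturality of \<open>\<iota>\<close> over the terminal bicategory holds automatically, since its only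
  1-cell is an identity.
\<close>

locale locally_iconic_transformation =
  fixes S :: "('o, 'f, 'x, 'm) tricat" and T :: "('p, 'g, 'y, 'n) tricat"
    and H :: "('o, 'f, 'x, 'm, 'p, 'g, 'y, 'n) trifun"
    and K :: "('o, 'f, 'x, 'm, 'p, 'g, 'y, 'n) trifun"
    and \<alpha> :: "('o, 'f, 'x, 'n) tricon"
  assumes src_trifunctor: "trifunctor S T H" and trg_trifunctor: "trifunctor S T K"
    and agree0: "a \<in> T0 S \<Longrightarrow> h0 H a = h0 K a"
    and local_icon: "\<lbrakk>a \<in> T0 S; b \<in> T0 S\<rbrakk> \<Longrightarrow> icon (hloc H a b) (hloc K a b) (icomp \<alpha> a b)"
    and Pi_hom2: "\<lbrakk>a \<in> T0 S; b \<in> T0 S; c \<in> T0 S; g \<in> Ob (Hom S b c); f \<in> Ob (Hom S a b)\<rbrakk>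
        \<Longrightarrow> iPi \<alpha> a b c (g, f) \<in> hom2 (Hom T (h0 H a) (h0 H c))
              (tc (fwd (chi K a b c)) (g, f)) (tc (fwd (chi H a b c)) (g, f))"
    and M_hom2: "a \<in> T0 S \<Longrightarrow> iM \<alpha> a \<in> hom2 (Hom T (h0 H a) (h0 H a))
        (tc (fwd (iota H a)) ()) (tc (fwd (iota K a)) ())"
    and chi_axiom: "\<lbrakk>a \<in> T0 S; b \<in> T0 S; c \<in> T0 S; v \<in> Arr (Hom S b c); u \<in> Arr (Hom S a b)\<rbrakk>
        \<Longrightarrow> tricon_chi_axiom S T H K \<alpha> (b, c, v) (a, b, u)"
    and omega_axiom: "\<lbrakk>a \<in> T0 S; b \<in> T0 S; c \<in> T0 S; d \<in> T0 S;
          x \<in> Ob (Hom S c d); y \<in> Ob (Hom S b c); z \<in> Ob (Hom S a b)\<rbrakk>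
        \<Longrightarrow> tricon_omega_axiom S T H K \<alpha> (c, d, x) (b, c, y) (a, b, z)"
    and gamma_axiom: "\<lbrakk>a \<in> T0 S; b \<in> T0 S; f \<in> Ob (Hom S a b)\<rbrakk>
        \<Longrightarrow> tricon_gamma_axiom S T H K \<alpha> (a, b, f)"
    and delta_axiom: "\<lbrakk>a \<in> T0 S; b \<in> T0 S; f \<in> Ob (Hom S a b)\<rbrakk>
        \<Longrightarrow> tricon_delta_axiom S T H K \<alpha> (a, b, f)"


section \<open>Monoidal categories and braidings\<close>

text \<open>\<open>marr M X Y\<close> is the set of morphisms \<open>X \<rightarrow> Y\<close>; \<open>mcomp M g f\<close> is \<open>g\<close> after \<open>f\<close>.\<close>

record ('x, 'm) moncat =
  mob :: "'x set"
  marr :: "'x \<Rightarrow> 'x \<Rightarrow> 'm set"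
  mid :: "'x \<Rightarrow> 'm"
  mcomp :: "'m \<Rightarrow> 'm \<Rightarrow> 'm"
  mten0 :: "'x \<Rightarrow> 'x \<Rightarrow> 'x"
  mten :: "'m \<Rightarrow> 'm \<Rightarrow> 'm"
  munit :: "'x"
  massoc :: "'x \<Rightarrow> 'x \<Rightarrow> 'x \<Rightarrow> 'm"
  mleft :: "'x \<Rightarrow> 'm"
  mright :: "'x \<Rightarrow> 'm"

record ('x, 'm) braided = "('x, 'm) moncat" +
  braid :: "'x \<Rightarrow> 'x \<Rightarrow> 'm"

definition minverse :: "('x, 'm, 'z) moncat_scheme \<Rightarrow> 'x \<Rightarrow> 'x \<Rightarrow> 'm \<Rightarrow> 'm \<Rightarrow> bool" where
  "minverse M X Y f g \<longleftrightarrow> f \<in> marr M X Y \<and> g \<in> marr M Y X \<and> mcomp M g f = mid M X \<and> mcomp M f g = mid M Y"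

definition miso :: "('x, 'm, 'z) moncat_scheme \<Rightarrow> 'x \<Rightarrow> 'x \<Rightarrow> 'm \<Rightarrow> bool" where
  "miso M X Y f \<longleftrightarrow> (\<exists>g. minverse M X Y f g)"

definition minv :: "('x, 'm, 'z) moncat_scheme \<Rightarrow> 'x \<Rightarrow> 'x \<Rightarrow> 'm \<Rightarrow> 'm" where
  "minv M X Y f = (THE g. minverse M X Y f g)"

locale monoidal_category =
  fixes M :: "('x, 'm, 'z) moncat_scheme"
  assumes mid_arr: "X \<in> mob M \<Longrightarrow> mid M X \<in> marr M X X"
    and arr_mob: "f \<in> marr M X Y \<Longrightarrow> X \<in> mob M \<and> Y \<in> mob M"
    and mcomp_arr: "\<lbrakk>f \<in> marr M X Y; g \<in> marr M Y Z\<rbrakk> \<Longrightarrow> mcomp M g f \<in> marr M X Z"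
    and mcomp_assoc: "\<lbrakk>f \<in> marr M W X; g \<in> marr M X Y; h \<in> marr M Y Z\<rbrakk>
        \<Longrightarrow> mcomp M (mcomp M h g) f = mcomp M h (mcomp M g f)"
    and mcomp_id: "f \<in> marr M X Y \<Longrightarrow> mcomp M f (mid M X) = f \<and> mcomp M (mid M Y) f = f"
    and mten0_mob: "\<lbrakk>X \<in> mob M; Y \<in> mob M\<rbrakk> \<Longrightarrow> mten0 M X Y \<in> mob M"
    and mten_arr: "\<lbrakk>f \<in> marr M X X'; g \<in> marr M Y Y'\<rbrakk> \<Longrightarrow> mten M f g \<in> marr M (mten0 M X Y) (mten0 M X' Y')"
    and mten_id: "\<lbrakk>X \<in> mob M; Y \<in> mob M\<rbrakk> \<Longrightarrow> mten M (mid M X) (mid M Y) = mid M (mten0 M X Y)"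
    and mten_comp: "\<lbrakk>f \<in> marr M X X'; f' \<in> marr M X' X''; g \<in> marr M Y Y'; g' \<in> marr M Y' Y''\<rbrakk>
        \<Longrightarrow> mten M (mcomp M f' f) (mcomp M g' g) = mcomp M (mten M f' g') (mten M f g)"
    and munit_mob: "munit M \<in> mob M"
    and massoc_iso: "\<lbrakk>X \<in> mob M; Y \<in> mob M; Z \<in> mob M\<rbrakk>
        \<Longrightarrow> miso M (mten0 M (mten0 M X Y) Z) (mten0 M X (mten0 M Y Z)) (massoc M X Y Z)"
    and massoc_nat: "\<lbrakk>f \<in> marr M X X'; g \<in> marr M Y Y'; h \<in> marr M Z Z'\<rbrakk>
        \<Longrightarrow> mcomp M (massoc M X' Y' Z') (mten M (mten M f g) h)
          = mcomp M (mten M f (mten M g h)) (massoc M X Y Z)"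
    and mleft_iso: "X \<in> mob M \<Longrightarrow> miso M (mten0 M (munit M) X) X (mleft M X)"
    and mleft_nat: "f \<in> marr M X Y
        \<Longrightarrow> mcomp M (mleft M Y) (mten M (mid M (munit M)) f) = mcomp M f (mleft M X)"
    and mright_iso: "X \<in> mob M \<Longrightarrow> miso M (mten0 M X (munit M)) X (mright M X)"
    and mright_nat: "f \<in> marr M X Y
        \<Longrightarrow> mcomp M (mright M Y) (mten M f (mid M (munit M))) = mcomp M f (mright M X)"
    and mpentagon: "\<lbrakk>W \<in> mob M; X \<in> mob M; Y \<in> mob M; Z \<in> mob M\<rbrakk>
        \<Longrightarrow> mcomp M (massoc M W X (mten0 M Y Z)) (massoc M (mten0 M W X) Y Z)
          = mcomp M (mten M (mid M W) (massoc M X Y Z))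
              (mcomp M (massoc M W (mten0 M X Y) Z) (mten M (massoc M W X Y) (mid M Z)))"
    and mtriangle: "\<lbrakk>X \<in> mob M; Y \<in> mob M\<rbrakk>
        \<Longrightarrow> mcomp M (mten M (mid M X) (mleft M Y)) (massoc M X (munit M) Y) = mten M (mright M X) (mid M Y)"

text \<open>Monoidal functors are strong, with constraints \<open>fm2 F X Y : FX \<otimes> FY \<rightarrow> F(X \<otimes> Y)\<close> and
  \<open>fm0 F : U \<rightarrow> FU\<close>. The record carries source and target as braided categories; the
  predicates below involve only the underlying monoidal categories.\<close>

record ('x, 'm, 'y, 'n) monfun =
  fmsrc :: "('x, 'm) braided"
  fmtrg :: "('y, 'n) braided"
  fmob :: "'x \<Rightarrow> 'y"
  fmarr :: "'m \<Rightarrow> 'n"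
  fm2 :: "'x \<Rightarrow> 'x \<Rightarrow> 'n"
  fm0 :: "'n"

locale monoidal_functor =
  fixes F :: "('x, 'm, 'y, 'n) monfun"
    and M :: "('x, 'm) braided" and N :: "('y, 'n) braided"
  defines "M \<equiv> fmsrc F" and "N \<equiv> fmtrg F"
  assumes src_moncat: "monoidal_category M" and trg_moncat: "monoidal_category N"
    and fmob_mob: "X \<in> mob M \<Longrightarrow> fmob F X \<in> mob N"
    and fmarr_arr: "f \<in> marr M X Y \<Longrightarrow> fmarr F f \<in> marr N (fmob F X) (fmob F Y)"
    and fmarr_id: "X \<in> mob M \<Longrightarrow> fmarr F (mid M X) = mid N (fmob F X)"
    and fmarr_comp: "\<lbrakk>f \<in> marr M X Y; g \<in> marr M Y Z\<rbrakk>
        \<Longrightarrow> fmarr F (mcomp M g f) = mcomp N (fmarr F g) (fmarr F f)"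
    and fm2_iso: "\<lbrakk>X \<in> mob M; Y \<in> mob M\<rbrakk>
        \<Longrightarrow> miso N (mten0 N (fmob F X) (fmob F Y)) (fmob F (mten0 M X Y)) (fm2 F X Y)"
    and fm2_nat: "\<lbrakk>f \<in> marr M X X'; g \<in> marr M Y Y'\<rbrakk>
        \<Longrightarrow> mcomp N (fm2 F X' Y') (mten N (fmarr F f) (fmarr F g))
          = mcomp N (fmarr F (mten M f g)) (fm2 F X Y)"
    and fm0_iso: "miso N (munit N) (fmob F (munit M)) (fm0 F)"
    and fm2_assoc: "\<lbrakk>X \<in> mob M; Y \<in> mob M; Z \<in> mob M\<rbrakk>
        \<Longrightarrow> mcomp N (fmarr F (massoc M X Y Z))
              (mcomp N (fm2 F (mten0 M X Y) Z) (mten N (fm2 F X Y) (mid N (fmob F Z))))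
          = mcomp N (fm2 F X (mten0 M Y Z))
              (mcomp N (mten N (mid N (fmob F X)) (fm2 F Y Z)) (massoc N (fmob F X) (fmob F Y) (fmob F Z)))"
    and fm0_left: "X \<in> mob M
        \<Longrightarrow> mcomp N (fmarr F (mleft M X)) (mcomp N (fm2 F (munit M) X) (mten N (fm0 F) (mid N (fmob F X))))
          = mleft N (fmob F X)"
    and fm0_right: "X \<in> mob M
        \<Longrightarrow> mcomp N (fmarr F (mright M X)) (mcomp N (fm2 F X (munit M)) (mten N (mid N (fmob F X)) (fm0 F)))
          = mright N (fmob F X)"

locale monoidal_transformation =
  fixes F :: "('x, 'm, 'y, 'n) monfun" and G :: "('x, 'm, 'y, 'n) monfun" and \<tau> :: "'x \<Rightarrow> 'n"
    and M :: "('x, 'm) braided" and N :: "('y, 'n) braided"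
  defines "M \<equiv> fmsrc F" and "N \<equiv> fmtrg F"
  assumes F_monoidal: "monoidal_functor F" and G_monoidal: "monoidal_functor G"
    and parallel: "fmsrc G = M" "fmtrg G = N"
    and comp_arr: "X \<in> mob M \<Longrightarrow> \<tau> X \<in> marr N (fmob F X) (fmob G X)"
    and comp_nat: "f \<in> marr M X Y \<Longrightarrow> mcomp N (\<tau> Y) (fmarr F f) = mcomp N (fmarr G f) (\<tau> X)"
    and comp_fm2: "\<lbrakk>X \<in> mob M; Y \<in> mob M\<rbrakk>
        \<Longrightarrow> mcomp N (\<tau> (mten0 M X Y)) (fm2 F X Y) = mcomp N (fm2 G X Y) (mten N (\<tau> X) (\<tau> Y))"
    and comp_fm0: "mcomp N (\<tau> (munit M)) (fm0 F) = fm0 G"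

text \<open>
  The Joyal--Street braiding obtained from a multiplication: a functor \<open>\<phi> : M \<times> M \<rightarrow> M\<close> (with
  object part \<open>p0\<close>, arrow part \<open>p1\<close>) with monoidal constraints
  \<open>p2 X X' Y Y' : \<phi>(X,X') \<otimes> \<phi>(Y,Y') \<rightarrow> \<phi>(X \<otimes> Y, X' \<otimes> Y')\<close> and unit isomorphisms
  \<open>l X : \<phi>(U,X) \<rightarrow> X\<close>, \<open>r X : \<phi>(X,U) \<rightarrow> X\<close>. It is the composite
  \<open>X \<otimes> Y \<cong> \<phi>(U,X) \<otimes> \<phi>(Y,U) \<cong> \<phi>(U \<otimes> Y, X \<otimes> U) \<cong> \<phi>(Y,X)
  \<cong> \<phi>(Y \<otimes> U, U \<otimes> X) \<cong> \<phi>(Y,U) \<otimes> \<phi>(U,X) \<cong> Y \<otimes> X\<close>, so that the multiplication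
  \<open>\<phi> = \<otimes>\<close> of a braided category gives back its braiding.
\<close>

definition joyal_street_braiding ::
  "('x, 'm, 'z) moncat_scheme \<Rightarrow> ('x \<Rightarrow> 'x \<Rightarrow> 'x) \<Rightarrow> ('m \<Rightarrow> 'm \<Rightarrow> 'm)
   \<Rightarrow> ('x \<Rightarrow> 'x \<Rightarrow> 'x \<Rightarrow> 'x \<Rightarrow> 'm) \<Rightarrow> ('x \<Rightarrow> 'm) \<Rightarrow> ('x \<Rightarrow> 'm) \<Rightarrow> 'x \<Rightarrow> 'x \<Rightarrow> 'm" where
  "joyal_street_braiding M p0 p1 p2 l r X Y =
    (let U = munit M;
         A = mten0 M (p0 U X) (p0 Y U);
         B = p0 (mten0 M U Y) (mten0 M X U);
         C = p0 (mten0 M Y U) (mten0 M U X);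
         D = mten0 M (p0 Y U) (p0 U X)
     in mcomp M (mten M (r Y) (l X))
          (mcomp M (minv M D C (p2 Y U U X))
            (mcomp M (minv M C (p0 Y X) (p1 (mright M Y) (mleft M X)))
              (mcomp M (p1 (mleft M Y) (mright M X))
                (mcomp M (p2 U X Y U)
                  (minv M A (mten0 M X Y) (mten M (l X) (r Y))))))))"


section \<open>The braided monoidal category of a doubly degenerate tricategory\<close>

definition one_object_moncat :: "('o, 'a, 'c) bicat \<Rightarrow> ('a, 'c) moncat" where
  "one_object_moncat B =
    \<lparr> mob = Arr B, marr = hom2 B, mid = id2 B, mcomp = vc B, mten0 = hc1 B, mten = hc2 B,
      munit = id1 B (the_elem (Ob B)), massoc = asc B, mleft = lun B, mright = run B \<rparr>"

definition zero_cell :: "('o, 'f, 'x, 'm) tricat \<Rightarrow> 'o" where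
  "zero_cell T = the_elem (T0 T)"

definition dd_hom :: "('o, 'f, 'x, 'm) tricat \<Rightarrow> ('f, 'x, 'm) bicat" where
  "dd_hom T = Hom T (zero_cell T) (zero_cell T)"

definition one_cell :: "('o, 'f, 'x, 'm) tricat \<Rightarrow> 'f" where
  "one_cell T = the_elem (Ob (dd_hom T))"

definition dd_ten :: "('o, 'f, 'x, 'm) tricat \<Rightarrow> ('f \<times> 'f, 'x \<times> 'x, 'm \<times> 'm, 'f, 'x, 'm) psf" where
  "dd_ten T = ten T (zero_cell T) (zero_cell T) (zero_cell T)"

definition dd_lft :: "('o, 'f, 'x, 'm) tricat \<Rightarrow> ('f, 'x, 'm, 'f, 'x, 'm) adj" where
  "dd_lft T = lft T (zero_cell T) (zero_cell T)"

definition dd_rgt :: "('o, 'f, 'x, 'm) tricat \<Rightarrow> ('f, 'x, 'm, 'f, 'x, 'm) adj" where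
  "dd_rgt T = rgt T (zero_cell T) (zero_cell T)"

definition dd_L :: "('o, 'f, 'x, 'm) tricat \<Rightarrow> 'x" where
  "dd_L T = tc (fwd (dd_lft T)) (one_cell T)"

definition dd_L_dual :: "('o, 'f, 'x, 'm) tricat \<Rightarrow> 'x" where
  "dd_L_dual T = tc (bwd (dd_lft T)) (one_cell T)"

definition dd_R :: "('o, 'f, 'x, 'm) tricat \<Rightarrow> 'x" where
  "dd_R T = tc (fwd (dd_rgt T)) (one_cell T)"

text \<open>\<open>L\<close> and \<open>R\<close> are isomorphic (Kelly's argument, from \<open>\<mu>\<close>, \<open>\<lambda>\<close>, \<open>\<rho>\<close>). The braiding below does
  not depend on the chosen isomorphism: a scalar multiplying it cancels.\<close>

definition dd_R_to_L :: "('o, 'f, 'x, 'm) tricat \<Rightarrow> 'm" where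
  "dd_R_to_L T = (SOME \<theta>. \<theta> \<in> hom2 (dd_hom T) (dd_R T) (dd_L T) \<and> iso2 (dd_hom T) \<theta>)"

text \<open>The multiplication \<open>\<phi>(X,Y) = R ((X \<boxtimes> Y) L\<^sup>\<cdot>)\<close>.\<close>

definition dd_mult0 :: "('o, 'f, 'x, 'm) tricat \<Rightarrow> 'x \<Rightarrow> 'x \<Rightarrow> 'x" where
  "dd_mult0 T X Y = (let B = dd_hom T in hc1 B (dd_R T) (hc1 B (f1 (dd_ten T) (X, Y)) (dd_L_dual T)))"

definition dd_mult1 :: "('o, 'f, 'x, 'm) tricat \<Rightarrow> 'm \<Rightarrow> 'm \<Rightarrow> 'm" where
  "dd_mult1 T f g = (let B = dd_hom T in
     hc2 B (id2 B (dd_R T)) (hc2 B (f2 (dd_ten T) (f, g)) (id2 B (dd_L_dual T))))"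

text \<open>Its monoidal constraint: cancel \<open>L\<^sup>\<cdot> R \<cong> L\<^sup>\<cdot> L \<cong> U\<close> in the middle, then use the
  constraint of \<open>\<boxtimes>\<close>.\<close>

definition dd_mult2 :: "('o, 'f, 'x, 'm) tricat \<Rightarrow> 'x \<Rightarrow> 'x \<Rightarrow> 'x \<Rightarrow> 'x \<Rightarrow> 'm" where
  "dd_mult2 T X X' Y Y' =
    (let B = dd_hom T; f = one_cell T; L = dd_L T; L' = dd_L_dual T; R = dd_R T; M = dd_ten T;
         a = f1 M (X, X'); b = f1 M (Y, Y')
     in paste B
          [join B f [R, a, L'] [R, b, L'],
           step B f [R, a, L'] ([R], dd_R_to_L T, [L]) [b, L'],
           step B f [R, a] ([L', L], inv2 B (eta (dd_lft T) f), []) [b, L'],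
           step B f [R] ([a, b], fmul M (X, X') (Y, Y'), [f1 M (hc1 B X Y, hc1 B X' Y')]) [L']])"

text \<open>Its unit isomorphisms, from the naturality of \<open>l\<close> and \<open>r\<close>:
  \<open>\<phi>(U,X) = R (U \<boxtimes> X) L\<^sup>\<cdot> \<cong> L (U \<boxtimes> X) L\<^sup>\<cdot> \<cong> X L L\<^sup>\<cdot> \<cong> X\<close> and
  \<open>\<phi>(X,U) = R (X \<boxtimes> U) L\<^sup>\<cdot> \<cong> X R L\<^sup>\<cdot> \<cong> X L L\<^sup>\<cdot> \<cong> X\<close>. Here \<open>J\<close> is the image of the
  identity under the unit functor, \<open>j : U \<cong> J\<close>.\<close>

definition dd_mult_left :: "('o, 'f, 'x, 'm) tricat \<Rightarrow> 'x \<Rightarrow> 'm" where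
  "dd_mult_left T X =
    (let B = dd_hom T; f = one_cell T; L = dd_L T; L' = dd_L_dual T; R = dd_R T; M = dd_ten T;
         U = id1 B f; J = f1 (uni T (zero_cell T)) (); j = funt (uni T (zero_cell T)) ()
     in paste B
          [step B f [R] ([f1 M (U, X)], f2 M (j, id2 B X), [f1 M (J, X)]) [L'],
           step B f [] ([R], dd_R_to_L T, [L]) [f1 M (J, X), L'],
           step B f [] ([L, f1 M (J, X)], tn (fwd (dd_lft T)) X, [X, L]) [L'],
           step B f [X] ([L, L'], eps (dd_lft T) f, []) []])"

definition dd_mult_right :: "('o, 'f, 'x, 'm) tricat \<Rightarrow> 'x \<Rightarrow> 'm" where
  "dd_mult_right T X =
    (let B = dd_hom T; f = one_cell T; L = dd_L T; L' = dd_L_dual T; R = dd_R T; M = dd_ten T;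
         U = id1 B f; J = f1 (uni T (zero_cell T)) (); j = funt (uni T (zero_cell T)) ()
     in paste B
          [step B f [R] ([f1 M (X, U)], f2 M (id2 B X, j), [f1 M (X, J)]) [L'],
           step B f [] ([R, f1 M (X, J)], tn (fwd (dd_rgt T)) X, [X, R]) [L'],
           step B f [X] ([R], dd_R_to_L T, [L]) [L'],
           step B f [X] ([L, L'], eps (dd_lft T) f, []) []])"

definition dd_braiding :: "('o, 'f, 'x, 'm) tricat \<Rightarrow> 'x \<Rightarrow> 'x \<Rightarrow> 'm" where
  "dd_braiding T = joyal_street_braiding (one_object_moncat (dd_hom T))
     (dd_mult0 T) (dd_mult1 T) (dd_mult2 T) (dd_mult_left T) (dd_mult_right T)"

definition dd_braided :: "('o, 'f, 'x, 'm) tricat \<Rightarrow> ('x, 'm) braided" where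
  "dd_braided T = moncat.extend (one_object_moncat (dd_hom T)) (braided.fields (dd_braiding T))"

text \<open>The braided monoidal functor underlying a weak functor: its local functor at the unique 0-cell.
  That it preserves the braidings is a consequence of the weak functor axioms.\<close>

definition dd_functor ::
  "('o, 'f, 'x, 'm) tricat \<Rightarrow> ('p, 'g, 'y, 'n) tricat \<Rightarrow> ('o, 'f, 'x, 'm, 'p, 'g, 'y, 'n) trifun
   \<Rightarrow> ('x, 'm, 'y, 'n) monfun" where
  "dd_functor S T H = (let F = hloc H (zero_cell S) (zero_cell S) in
     \<lparr> fmsrc = dd_braided S, fmtrg = dd_braided T, fmob = f1 F, fmarr = f2 F, fm2 = fmul F,
       fm0 = funt F (one_cell S) \<rparr>)"

end

theory Submission
  imports Defs
begin

text \<open>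
  Only the local icon at the unique 0-cell matters. For one-object bicategories the axioms of
  bicategories, weak functors and icons are literally those of monoidal categories, monoidal functors
  and monoidal transformations; the one difference is that the unit constraint of a functor and its
  compatibility with an icon are indexed by the single object.
\<close>

text \<open>With a single object, endpoint conditions are vacuous. As a rewrite rule this reduces
  the typed premises of the bicategory axioms to membership in \<open>Arr B\<close>, which is all
  that the monoidal axioms provide.\<close>

lemma hom1_one_object:
  assumes "bicategory B" and "Ob B = {X}"
  shows "hom1 B X X = Arr B"
  using bicategory.Src_Ob[OF assms(1)] bicategory.Trg_Ob[OF assms(1)] assms(2)
  by (auto simp: hom1_def)

text \<open>\<open>inverse2\<close> already carries the boundaries and both cancellation laws
  demanded by \<open>minverse\<close>. Assuming only that three fields agree, instead of fixing
  \<open>M\<close>, lets the lemma apply to the extended record \<open>dd_braided T\<close>.\<close>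

lemma miso_if_iso2:
  assumes "marr M = hom2 B" "mcomp M = vc B" "mid M = id2 B"
    and "\<alpha> \<in> hom2 B f g" "iso2 B \<alpha>"
  shows "miso M f g \<alpha>"
  using assms unfolding miso_def minverse_def iso2_def inverse2_def by (auto simp: hom2_def)

text \<open>These rules turn the monoidal axioms of \<open>dd_braided T\<close> into statements
  about \<open>dd_hom T\<close>. The unit lands at \<open>one_cell T\<close>, which is by definition
  the \<open>the_elem\<close> occurring in \<open>one_object_moncat\<close>.\<close>

lemma dd_braided_simps [simp]:
  "mob (dd_braided T) = Arr (dd_hom T)"
  "marr (dd_braided T) = hom2 (dd_hom T)"
  "mid (dd_braided T) = id2 (dd_hom T)"
  "mcomp (dd_braided T) = vc (dd_hom T)"
  "mten0 (dd_braided T) = hc1 (dd_hom T)"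
  "mten (dd_braided T) = hc2 (dd_hom T)"
  "munit (dd_braided T) = id1 (dd_hom T) (one_cell T)"
  "massoc (dd_braided T) = asc (dd_hom T)"
  "mleft (dd_braided T) = lun (dd_hom T)"
  "mright (dd_braided T) = run (dd_hom T)"
  by (simp_all add: dd_braided_def one_object_moncat_def moncat.defs one_cell_def)

lemma zero_cell_T0:
  assumes "doubly_degenerate T"
  shows "T0 T = {zero_cell T}"
  using assms by (auto simp: doubly_degenerate_def zero_cell_def)

lemma Ob_dd_hom:
  assumes "doubly_degenerate T"
  shows "Ob (dd_hom T) = {one_cell T}"
  using assms by (auto simp: doubly_degenerate_def zero_cell_def dd_hom_def one_cell_def)

lemma dd_bicategory:
  assumes "tricategory T" and "doubly_degenerate T"
  shows "bicategory (dd_hom T)"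
  unfolding dd_hom_def using zero_cell_T0[OF assms(2)] tricategory.hom_bicat[OF assms(1)] by simp

text \<open>Each law is the bicategory law of the same shape. The work lies in discharging endpoint
  and composability conditions, which hold automatically over one object.\<close>

lemma dd_braided_monoidal:
  assumes "tricategory T" and "doubly_degenerate T"
  shows "monoidal_category (dd_braided T)"
proof -
  let ?B = "dd_hom T" and ?X = "one_cell T"
  interpret bicategory ?B by (rule dd_bicategory[OF assms])
  note Ob = Ob_dd_hom[OF assms(2)]
  note hom1 = hom1_one_object[OF bicategory_axioms Ob]
  \<comment> \<open>\<open>Dom_Arr\<close> covers the source; the target is an arrow because
    \<open>Cod_hom1\<close> places it in a \<open>hom1\<close>.\<close>
  have arr: "f \<in> Arr ?B" "g \<in> Arr ?B" if "\<alpha> \<in> hom2 ?B f g" for \<alpha> f g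
    using that Dom_Arr Cod_hom1 by (auto simp: hom2_def hom1_def)
  have ends: "Src ?B f = ?X" "Trg ?B f = ?X" if "f \<in> Arr ?B" for f
    using that Src_Ob Trg_Ob Ob by auto
  \<comment> \<open>\<open>hc2_hom2\<close>, \<open>interchange\<close> and \<open>asc_nat\<close>
    ask for composable boundaries; here any two cells qualify.\<close>
  have adj: "Trg ?B f = Src ?B g" if "\<alpha> \<in> hom2 ?B f f'" "\<beta> \<in> hom2 ?B g g'" for \<alpha> \<beta> f f' g g'
    using arr(1)[OF that(1)] arr(1)[OF that(2)] ends by simp
  have unit: "id1 ?B ?X \<in> Arr ?B"
    using id1_hom1[of ?X] Ob by (simp add: hom1)
  note miso = miso_if_iso2[of "dd_braided T" ?B]
  show ?thesis
  proof (unfold_locales, unfold dd_braided_simps)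
    fix X assume "X \<in> Arr ?B"
    then show "id2 ?B X \<in> hom2 ?B X X" by (rule id2_hom2)
  next
    fix f X Y assume "f \<in> hom2 ?B X Y"
    then show "X \<in> Arr ?B \<and> Y \<in> Arr ?B" using arr by blast
  next
    fix X Y assume "X \<in> Arr ?B" "Y \<in> Arr ?B"
    \<comment> \<open>Composition is in applicative order, so the last tensor factor is the first
      arrow and instantiations list the factors backwards. \<open>?X\<close> is the single object,
      while \<open>X\<close> is a 1-cell.\<close>
    then show "hc1 ?B X Y \<in> Arr ?B" using hc1_hom1[of Y ?X ?X X ?X] by (simp add: hom1)
  next
    fix X Y assume "X \<in> Arr ?B" "Y \<in> Arr ?B"
    then show "hc2 ?B (id2 ?B X) (id2 ?B Y) = id2 ?B (hc1 ?B X Y)"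
      using hc2_id[of Y ?X ?X X ?X] by (simp add: hom1)
  next
    fix X Y Z assume "X \<in> Arr ?B" "Y \<in> Arr ?B" "Z \<in> Arr ?B"
    then show "miso (dd_braided T) (hc1 ?B (hc1 ?B X Y) Z) (hc1 ?B X (hc1 ?B Y Z)) (asc ?B X Y Z)"
      by (intro miso asc_hom2[of Z ?X ?X Y ?X X ?X] asc_iso[of Z ?X ?X Y ?X X ?X]) (simp_all add: hom1)
  next
    fix X assume "X \<in> Arr ?B"
    then show "miso (dd_braided T) (hc1 ?B (id1 ?B ?X) X) X (lun ?B X)"
      by (intro miso lun_hom2[of X ?X ?X] lun_iso) (simp_all add: hom1)
  next
    fix X assume "X \<in> Arr ?B"
    then show "miso (dd_braided T) (hc1 ?B X (id1 ?B ?X)) X (run ?B X)"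
      by (intro miso run_hom2[of X ?X ?X] run_iso) (simp_all add: hom1)
  next
    fix W X Y Z assume "W \<in> Arr ?B" "X \<in> Arr ?B" "Y \<in> Arr ?B" "Z \<in> Arr ?B"
    then show "vc ?B (asc ?B W X (hc1 ?B Y Z)) (asc ?B (hc1 ?B W X) Y Z)
        = vc ?B (hc2 ?B (id2 ?B W) (asc ?B X Y Z))
            (vc ?B (asc ?B W (hc1 ?B X Y) Z) (hc2 ?B (asc ?B W X Y) (id2 ?B Z)))"
      using pentagon[of Z ?X ?X Y ?X X ?X W ?X] by (simp add: hom1)
  next
    fix X Y assume "X \<in> Arr ?B" "Y \<in> Arr ?B"
    then show "vc ?B (hc2 ?B (id2 ?B X) (lun ?B Y)) (asc ?B X (id1 ?B ?X) Y) = hc2 ?B (run ?B X) (id2 ?B Y)"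
      using triangle[of Y ?X ?X X ?X] by (simp add: hom1)
  next
    fix f X Y assume "f \<in> hom2 ?B X Y"
    then show "vc ?B f (id2 ?B X) = f \<and> vc ?B (id2 ?B Y) f = f"
      by (simp add: vc_id_left vc_id_right)
  next
    fix f X X' g Y Y' assume "f \<in> hom2 ?B X X'" "g \<in> hom2 ?B Y Y'"
    then show "hc2 ?B f g \<in> hom2 ?B (hc1 ?B X Y) (hc1 ?B X' Y')"
      by (intro hc2_hom2 adj)
  next
    fix f X X' f' X'' g Y Y' g' Y''
    assume "f \<in> hom2 ?B X X'" "f' \<in> hom2 ?B X' X''" "g \<in> hom2 ?B Y Y'" "g' \<in> hom2 ?B Y' Y''"
    then show "hc2 ?B (vc ?B f' f) (vc ?B g' g) = vc ?B (hc2 ?B f' g') (hc2 ?B f g)"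
      by (intro interchange adj)
  next
    fix f X X' g Y Y' h Z Z'
    assume "f \<in> hom2 ?B X X'" "g \<in> hom2 ?B Y Y'" "h \<in> hom2 ?B Z Z'"
    then show "vc ?B (asc ?B X' Y' Z') (hc2 ?B (hc2 ?B f g) h)
        = vc ?B (hc2 ?B f (hc2 ?B g h)) (asc ?B X Y Z)"
      by (intro asc_nat adj)
  next
    fix f X Y assume "f \<in> hom2 ?B X Y"
    then show "vc ?B (lun ?B Y) (hc2 ?B (id2 ?B (id1 ?B ?X)) f) = vc ?B f (lun ?B X)"
      by (intro lun_nat ends arr)
  next
    fix f X Y assume "f \<in> hom2 ?B X Y"
    then show "vc ?B (run ?B Y) (hc2 ?B f (id2 ?B (id1 ?B ?X))) = vc ?B f (run ?B X)"
      by (intro run_nat ends arr)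
  \<comment> \<open>What remains is \<open>munit_mob\<close>, \<open>mcomp_arr\<close> and
    \<open>mcomp_assoc\<close>, each literally one of these facts.\<close>
  qed (fact unit vc_hom2 vc_assoc)+
qed

lemma dd_functor_simps:
  "fmsrc (dd_functor S T H) = dd_braided S"
  "fmtrg (dd_functor S T H) = dd_braided T"
  "fmob (dd_functor S T H) = f1 (hloc H (zero_cell S) (zero_cell S))"
  "fmarr (dd_functor S T H) = f2 (hloc H (zero_cell S) (zero_cell S))"
  "fm2 (dd_functor S T H) = fmul (hloc H (zero_cell S) (zero_cell S))"
  "fm0 (dd_functor S T H) = funt (hloc H (zero_cell S) (zero_cell S)) (one_cell S)"
  by (simp_all add: dd_functor_def Let_def)

context
  fixes S :: "('o, 'f, 'x, 'm) tricat" and T :: "('p, 'g, 'y, 'n) tricat"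
    and H :: "('o, 'f, 'x, 'm, 'p, 'g, 'y, 'n) trifun"
  assumes H: "trifunctor S T H" and S: "doubly_degenerate S" and T: "doubly_degenerate T"
begin

text \<open>A priori the target is the hom-bicategory of \<open>T\<close> at
  \<open>h0 H (zero_cell S)\<close>; since \<open>T\<close> has only one 0-cell, this is
  \<open>dd_hom T\<close>.\<close>

lemma dd_hloc:
  "pseudofunctor (hloc H (zero_cell S) (zero_cell S))"
  "fsrc (hloc H (zero_cell S) (zero_cell S)) = dd_hom S"
  "ftrg (hloc H (zero_cell S) (zero_cell S)) = dd_hom T"
  using trifunctor.hloc_psf[OF H, of "zero_cell S" "zero_cell S"]
    trifunctor.h0_T0[OF H, of "zero_cell S"] zero_cell_T0[OF S] zero_cell_T0[OF T]
  by (auto simp: dd_hom_def)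

lemma dd_functor_monoidal: "monoidal_functor (dd_functor S T H)"
proof -
  let ?F = "hloc H (zero_cell S) (zero_cell S)" and ?B = "dd_hom S" and ?C = "dd_hom T"
  let ?X = "one_cell S"
  note psf = dd_hloc(1)
  \<comment> \<open>The axioms of \<open>pseudofunctor\<close> speak of \<open>fsrc\<close> and
    \<open>ftrg\<close>; unfolding with these equations restates them over \<open>dd_hom S\<close>
    and \<open>dd_hom T\<close>.\<close>
  note ends = dd_hloc(2,3)
  note S_bicat = dd_bicategory[OF trifunctor.src_tricat[OF H] S]
  note T_bicat = dd_bicategory[OF trifunctor.trg_tricat[OF H] T]
  note Ob = Ob_dd_hom[OF S]
  note hom1 = hom1_one_object[OF S_bicat Ob]
  have X: "?X \<in> Ob ?B" by (simp add: Ob)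
  \<comment> \<open>The unit constraint starts at the identity on \<open>f0 ?F ?X\<close>, whereas
    the monoidal unit of the target is the identity on \<open>one_cell T\<close>; the two objects
    agree because there is only one.\<close>
  have f0: "f0 ?F ?X = one_cell T"
    using pseudofunctor.f0_Ob[OF psf, unfolded ends, OF X] Ob_dd_hom[OF T] by simp
  note hom1_T = hom1_one_object[OF T_bicat Ob_dd_hom[OF T]]
  have adj: "Trg ?B f = Src ?B g" if "\<alpha> \<in> hom2 ?B f f'" "\<beta> \<in> hom2 ?B g g'" for \<alpha> \<beta> f f' g g'
    using that bicategory.Dom_Arr[OF S_bicat] bicategory.Src_Ob[OF S_bicat]
      bicategory.Trg_Ob[OF S_bicat] Ob by (auto simp: hom2_def)
  note miso = miso_if_iso2[of "dd_braided T" ?C]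
  show ?thesis
  proof (rule monoidal_functor.intro, unfold dd_functor_simps dd_braided_simps)
    show "monoidal_category (dd_braided S)"
      by (rule dd_braided_monoidal[OF trifunctor.src_tricat[OF H] S])
    show "monoidal_category (dd_braided T)"
      by (rule dd_braided_monoidal[OF trifunctor.trg_tricat[OF H] T])
    show "miso (dd_braided T) (id1 ?C (one_cell T)) (f1 ?F (id1 ?B ?X)) (funt ?F ?X)"
      using pseudofunctor.funt_hom2[OF psf, unfolded ends, OF X]
        pseudofunctor.funt_iso[OF psf, unfolded ends, OF X]
      by (intro miso) (simp_all add: f0)
  next
    fix X assume "X \<in> Arr ?B"
    then show "f1 ?F X \<in> Arr ?C"
      using pseudofunctor.f1_hom1[OF psf, unfolded ends, of X ?X ?X] by (simp add: hom1 f0 hom1_T)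
  next
    fix f X Y assume "f \<in> hom2 ?B X Y"
    then show "f2 ?F f \<in> hom2 ?C (f1 ?F X) (f1 ?F Y)"
      by (rule pseudofunctor.f2_hom2[OF psf, unfolded ends])
  next
    fix X assume "X \<in> Arr ?B"
    then show "f2 ?F (id2 ?B X) = id2 ?C (f1 ?F X)"
      by (rule pseudofunctor.f2_id[OF psf, unfolded ends])
  next
    fix f g X Y Z assume "f \<in> hom2 ?B X Y" "g \<in> hom2 ?B Y Z"
    then show "f2 ?F (vc ?B g f) = vc ?C (f2 ?F g) (f2 ?F f)"
      by (rule pseudofunctor.f2_vc[OF psf, unfolded ends])
  next
    fix X Y assume "X \<in> Arr ?B" "Y \<in> Arr ?B"
    then show "miso (dd_braided T) (hc1 ?C (f1 ?F X) (f1 ?F Y)) (f1 ?F (hc1 ?B X Y)) (fmul ?F X Y)"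
      using pseudofunctor.fmul_hom2[OF psf, unfolded ends, of Y ?X ?X X ?X]
        pseudofunctor.fmul_iso[OF psf, unfolded ends, of Y ?X ?X X ?X]
      by (intro miso) (simp_all add: hom1)
  next
    fix f g X X' Y Y' assume "f \<in> hom2 ?B X X'" "g \<in> hom2 ?B Y Y'"
    then show "vc ?C (fmul ?F X' Y') (hc2 ?C (f2 ?F f) (f2 ?F g))
        = vc ?C (f2 ?F (hc2 ?B f g)) (fmul ?F X Y)"
      by (intro pseudofunctor.fmul_nat[OF psf, unfolded ends] adj)
  next
    fix X Y Z assume "X \<in> Arr ?B" "Y \<in> Arr ?B" "Z \<in> Arr ?B"
    then show "vc ?C (f2 ?F (asc ?B X Y Z))
          (vc ?C (fmul ?F (hc1 ?B X Y) Z) (hc2 ?C (fmul ?F X Y) (id2 ?C (f1 ?F Z))))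
        = vc ?C (fmul ?F X (hc1 ?B Y Z))
            (vc ?C (hc2 ?C (id2 ?C (f1 ?F X)) (fmul ?F Y Z)) (asc ?C (f1 ?F X) (f1 ?F Y) (f1 ?F Z)))"
      by (intro pseudofunctor.fmul_assoc[OF psf, unfolded ends, of Z ?X ?X Y ?X X ?X])
        (simp_all add: hom1)
  next
    fix X assume "X \<in> Arr ?B"
    then show "vc ?C (f2 ?F (lun ?B X))
          (vc ?C (fmul ?F (id1 ?B ?X) X) (hc2 ?C (funt ?F ?X) (id2 ?C (f1 ?F X))))
        = lun ?C (f1 ?F X)"
      by (intro pseudofunctor.funt_left[OF psf, unfolded ends, of X ?X ?X]) (simp add: hom1)
  next
    fix X assume "X \<in> Arr ?B"
    then show "vc ?C (f2 ?F (run ?B X))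
          (vc ?C (fmul ?F X (id1 ?B ?X)) (hc2 ?C (id2 ?C (f1 ?F X)) (funt ?F ?X)))
        = run ?C (f1 ?F X)"
      by (intro pseudofunctor.funt_right[OF psf, unfolded ends, of X ?X ?X]) (simp add: hom1)
  qed
qed

end

theorem theorem2p13:
  fixes S :: "('o, 'f, 'x, 'm) tricat" and T :: "('p, 'g, 'y, 'n) tricat"
    and H :: "('o, 'f, 'x, 'm, 'p, 'g, 'y, 'n) trifun"
    and K :: "('o, 'f, 'x, 'm, 'p, 'g, 'y, 'n) trifun"
    and \<alpha> :: "('o, 'f, 'x, 'n) tricon"
  assumes "tricategory S" and "tricategory T"
    and "doubly_degenerate S" and "doubly_degenerate T"
    and "trifunctor S T H" and "trifunctor S T K"
    and "locally_iconic_transformation S T H K \<alpha>"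
  shows "monoidal_transformation (dd_functor S T H) (dd_functor S T K)
           (icomp \<alpha> (zero_cell S) (zero_cell S))"
proof -
  let ?F = "hloc H (zero_cell S) (zero_cell S)" and ?G = "hloc K (zero_cell S) (zero_cell S)"
  let ?\<alpha> = "icomp \<alpha> (zero_cell S) (zero_cell S)" and ?X = "one_cell S"
  note S_dd = assms(3) and T_dd = assms(4) and H = assms(5) and K = assms(6)
  have "icon ?F ?G ?\<alpha>"
    using locally_iconic_transformation.local_icon[OF assms(7)] zero_cell_T0[OF S_dd] by simp
  \<comment> \<open>The locale \<open>icon\<close> takes its two bicategories from its first
    functor, so the equations for \<open>H\<close> suffice to restate its axioms.\<close>
  note icon = this and ends = dd_hloc(2,3)[OF H S_dd T_dd]
  note Ob = Ob_dd_hom[OF S_dd]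
  note hom1 = hom1_one_object[OF dd_bicategory[OF assms(1) S_dd] Ob]
  show ?thesis
  proof (rule monoidal_transformation.intro, unfold dd_functor_simps dd_braided_simps)
    show "monoidal_functor (dd_functor S T H)" by (rule dd_functor_monoidal[OF H S_dd T_dd])
    show "monoidal_functor (dd_functor S T K)" by (rule dd_functor_monoidal[OF K S_dd T_dd])
  next
    fix X assume "X \<in> Arr (dd_hom S)"
    then show "?\<alpha> X \<in> hom2 (dd_hom T) (f1 ?F X) (f1 ?G X)"
      by (rule icon.comp_hom2[OF icon, unfolded ends])
  next
    fix f X Y assume "f \<in> hom2 (dd_hom S) X Y"
    then show "vc (dd_hom T) (?\<alpha> Y) (f2 ?F f) = vc (dd_hom T) (f2 ?G f) (?\<alpha> X)"
      by (rule icon.comp_nat[OF icon, unfolded ends])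
  next
    fix X Y assume "X \<in> Arr (dd_hom S)" "Y \<in> Arr (dd_hom S)"
    then show "vc (dd_hom T) (?\<alpha> (hc1 (dd_hom S) X Y)) (fmul ?F X Y)
        = vc (dd_hom T) (fmul ?G X Y) (hc2 (dd_hom T) (?\<alpha> X) (?\<alpha> Y))"
      by (intro icon.comp_mul[OF icon, unfolded ends, of Y ?X ?X X ?X]) (simp_all add: hom1)
  next
    show "vc (dd_hom T) (?\<alpha> (id1 (dd_hom S) ?X)) (funt ?F ?X) = funt ?G ?X"
      by (intro icon.comp_unt[OF icon, unfolded ends]) (simp add: Ob)
  \<comment> \<open>The two \<open>parallel\<close> conditions are left: source and target of
    \<open>dd_functor\<close> depend only on \<open>S\<close> and \<open>T\<close>.\<close>
  qed simp_all
qed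

end
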